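(* Let $G$ be a definable group in a simple theory, and let $\mathfrak{F}$ be a family of uniformly definable subgroups of $G$. Then there are integers $k,k'<\omega$ such that any intersection $N$ of elements of $\mathfrak{F}$ is commensurable with a subintersection $N_0$ of size at most $k$ (that is, $N_0$ is the intersection of at most $k$ of the members of $\mathfrak{F}$ whose intersection is $N$), and $|N_0 : N_0\cap H|\leq k'$ for any $H\in\mathfrak{F}$ with $H\geq N$. Furthermore, there is an integer $n<\omega$ such that any chain of intersections of elements of $\mathfrak{F}$, each of infinite index in its predecessor, has length at most $n$.
   Context: A family $\mathfrak{F}$ of subgroups of $G$ is uniformly definable if there is a fixed formula $\varphi(x,\bar y)$ such that every member of $\mathfrak{F}$ is of the form $\{g\in G : G\models\varphi(g,\bar a)\}$ for some parameter tuple $\bar a$, where only the parameters vary. Intersections of members of $\mathfrak{F}$ may be infinite, and are then type-definable groups, i.e. groups given as the set of realizations of a partial type (in any elementary superstructure). If $H\leq K$ are type-definable groups, $H$ has bounded index in $K$ if the index $|K^{\mathcal M}:H^{\mathcal M}|$ remains bounded as $\mathcal M$ ranges over all elementary superstructures of the ambient structure. Two groups are commensurable if their intersection has finite index in each of them; for type-definable groups, commensurability means that the intersection has bounded (rather than finite) index in each of them.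
   Formalization: In the chain claim, "infinite index" means unbounded index (literally infinite index fails). N_0 is an intersection of members of F containing N, with H any member of F above N; if N_0 is taken from a given subfamily with intersection N, H ranges only over that subfamily. *)

theory Defs
  imports "HOL-Algebra.Coset" "HOL-Library.Equipollence"
begin

(* First-order logic with equality.  A language is a set of function symbols and a set of
   relation symbols, each with its arity; constants are function symbols of arity 0. *)

type_synonym ('f, 'r) language = "('f \<times> nat) set \<times> ('r \<times> nat) set"

datatype 'f tm = Var nat | App 'f "'f tm list"

datatype ('f, 'r) fm =
    Eql "'f tm" "'f tm"
  | Rel 'r "'f tm list"
  | Neg "('f, 'r) fm"
  | Conj "('f, 'r) fm" "('f, 'r) fm"
  | Ex nat "('f, 'r) fm"

fun tm_in :: "('f, 'r) language \<Rightarrow> 'f tm \<Rightarrow> bool" where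
  "tm_in L (Var i) \<longleftrightarrow> True"
| "tm_in L (App f ts) \<longleftrightarrow> (f, length ts) \<in> fst L \<and> (\<forall>t \<in> set ts. tm_in L t)"

fun fm_in :: "('f, 'r) language \<Rightarrow> ('f, 'r) fm \<Rightarrow> bool" where
  "fm_in L (Eql s t) \<longleftrightarrow> tm_in L s \<and> tm_in L t"
| "fm_in L (Rel r ts) \<longleftrightarrow> (r, length ts) \<in> snd L \<and> (\<forall>t \<in> set ts. tm_in L t)"
| "fm_in L (Neg \<phi>) \<longleftrightarrow> fm_in L \<phi>"
| "fm_in L (Conj \<phi> \<psi>) \<longleftrightarrow> fm_in L \<phi> \<and> fm_in L \<psi>"
| "fm_in L (Ex i \<phi>) \<longleftrightarrow> fm_in L \<phi>"

fun tm_vars :: "'f tm \<Rightarrow> nat set" where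
  "tm_vars (Var i) = {i}"
| "tm_vars (App f ts) = (\<Union>t \<in> set ts. tm_vars t)"

fun free_vars :: "('f, 'r) fm \<Rightarrow> nat set" where
  "free_vars (Eql s t) = tm_vars s \<union> tm_vars t"
| "free_vars (Rel r ts) = (\<Union>t \<in> set ts. tm_vars t)"
| "free_vars (Neg \<phi>) = free_vars \<phi>"
| "free_vars (Conj \<phi> \<psi>) = free_vars \<phi> \<union> free_vars \<psi>"
| "free_vars (Ex i \<phi>) = free_vars \<phi> - {i}"

definition fms :: "('f, 'r) language \<Rightarrow> nat \<Rightarrow> ('f, 'r) fm set" where
  "fms L n = {\<phi>. fm_in L \<phi> \<and> free_vars \<phi> \<subseteq> {..<n}}"

record ('f, 'r, 'm) struct =
  univ :: "'m set"
  fn :: "'f \<Rightarrow> 'm list \<Rightarrow> 'm"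
  rel :: "'r \<Rightarrow> 'm list \<Rightarrow> bool"

definition tuples :: "('f, 'r, 'm) struct \<Rightarrow> nat \<Rightarrow> 'm list set" where
  "tuples M n = {xs. length xs = n \<and> set xs \<subseteq> univ M}"

(* The values of fn and rel at symbols outside the language are irrelevant. *)
definition is_structure :: "('f, 'r) language \<Rightarrow> ('f, 'r, 'm) struct \<Rightarrow> bool" where
  "is_structure L M \<longleftrightarrow>
     univ M \<noteq> {} \<and> (\<forall>(f, n) \<in> fst L. \<forall>xs \<in> tuples M n. fn M f xs \<in> univ M)"

fun eval :: "('f, 'r, 'm) struct \<Rightarrow> (nat \<Rightarrow> 'm) \<Rightarrow> 'f tm \<Rightarrow> 'm" where
  "eval M s (Var i) = s i"
| "eval M s (App f ts) = fn M f (map (eval M s) ts)"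

fun sat :: "('f, 'r, 'm) struct \<Rightarrow> (nat \<Rightarrow> 'm) \<Rightarrow> ('f, 'r) fm \<Rightarrow> bool" where
  "sat M s (Eql t u) \<longleftrightarrow> eval M s t = eval M s u"
| "sat M s (Rel r ts) \<longleftrightarrow> rel M r (map (eval M s) ts)"
| "sat M s (Neg \<phi>) \<longleftrightarrow> \<not> sat M s \<phi>"
| "sat M s (Conj \<phi> \<psi>) \<longleftrightarrow> sat M s \<phi> \<and> sat M s \<psi>"
| "sat M s (Ex i \<phi>) \<longleftrightarrow> (\<exists>x \<in> univ M. sat M (s(i := x)) \<phi>)"

(* Only used for formulas whose free variables are below the length of the tuple. *)
definition holds :: "('f, 'r, 'm) struct \<Rightarrow> ('f, 'r) fm \<Rightarrow> 'm list \<Rightarrow> bool" where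
  "holds M \<phi> xs \<longleftrightarrow> sat M (\<lambda>i. xs ! i) \<phi>"

definition models :: "('f, 'r) language \<Rightarrow> ('f, 'r, 'm) struct \<Rightarrow> ('f, 'r) fm set \<Rightarrow> bool" where
  "models L M T \<longleftrightarrow> is_structure L M \<and> (\<forall>\<phi> \<in> T. holds M \<phi> [])"

(* Superstructures are taken up to isomorphism: the inclusion is an elementary embedding e. *)
definition elementary_ext ::
  "('f, 'r) language \<Rightarrow> ('f, 'r, 'm) struct \<Rightarrow> ('f, 'r, 'u) struct \<Rightarrow> ('m \<Rightarrow> 'u) \<Rightarrow> bool" where
  "elementary_ext L M N e \<longleftrightarrow> is_structure L N \<and> e ` univ M \<subseteq> univ N \<and>
     (\<forall>n. \<forall>\<phi> \<in> fms L n. \<forall>xs \<in> tuples M n. holds M \<phi> xs \<longleftrightarrow> holds N \<phi> (map e xs))"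

(* Shelah's tree property of the formula \<phi>(x;y), where x are the first p variables and y the next
   q ones: siblings are k-inconsistent, branches are consistent.  By compactness consistency of a
   branch is finite satisfiability. *)
definition tree_property ::
  "('f, 'r, 'u) struct \<Rightarrow> ('f, 'r) fm \<Rightarrow> nat \<Rightarrow> nat \<Rightarrow> bool" where
  "tree_property N \<phi> p q \<longleftrightarrow>
     (\<exists>k \<ge> 2. \<exists>a :: nat list \<Rightarrow> 'u list.
        (\<forall>s. a s \<in> tuples N q) \<and>
        (\<forall>s. \<forall>I :: nat set. finite I \<and> card I = k \<longrightarrow>
           \<not> (\<exists>x \<in> tuples N p. \<forall>i \<in> I. holds N \<phi> (x @ a (s @ [i])))) \<and>
        (\<forall>\<sigma> :: nat \<Rightarrow> nat. \<forall>n. \<exists>x \<in> tuples N p. \<forall>m \<le> n.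
           holds N \<phi> (x @ a (map \<sigma> [0..<m]))))"

(* In all definitions with an argument of type 'u itself, quantification over structures is
   quantification over structures whose universe is a subset of 'u.  This says what it should once 'u has more elements than there are sets of formulas
   with parameters in M: then any failure of simplicity, of an inclusion or of boundedness is
   witnessed by a structure on 'u (Loewenheim-Skolem, compactness). *)

definition simple_theory ::
  "('f, 'r) language \<Rightarrow> ('f, 'r) fm set \<Rightarrow> 'u itself \<Rightarrow> bool" where
  "simple_theory L T U \<longleftrightarrow> T \<subseteq> fms L 0 \<and>
     (\<forall>N :: ('f, 'r, 'u) struct. models L N T \<longrightarrow>
        (\<forall>p q. \<forall>\<phi> \<in> fms L (p + q). \<not> tree_property N \<phi> p q))"

definition defset :: "('f, 'r, 'm) struct \<Rightarrow> nat \<Rightarrow> ('f, 'r) fm \<Rightarrow> 'm list \<Rightarrow> 'm list set" where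
  "defset M d \<phi> a = {x \<in> tuples M d. holds M \<phi> (x @ a)}"

definition definable ::
  "('f, 'r) language \<Rightarrow> ('f, 'r, 'm) struct \<Rightarrow> nat \<Rightarrow> 'm list set \<Rightarrow> bool" where
  "definable L M d D \<longleftrightarrow> (\<exists>q. \<exists>\<phi> \<in> fms L (d + q). \<exists>a \<in> tuples M q. D = defset M d \<phi> a)"

definition mult_graph :: "'m list monoid \<Rightarrow> 'm list set" where
  "mult_graph G = {x @ y @ (x \<otimes>\<^bsub>G\<^esub> y) | x y. x \<in> carrier G \<and> y \<in> carrier G}"

definition definable_group ::
  "('f, 'r) language \<Rightarrow> ('f, 'r, 'm) struct \<Rightarrow> nat \<Rightarrow> 'm list monoid \<Rightarrow> bool" where
  "definable_group L M d G \<longleftrightarrow>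
     group G \<and> definable L M d (carrier G) \<and> definable L M (3 * d) (mult_graph G)"

definition uniformly_definable_subgroups ::
  "('f, 'r) language \<Rightarrow> ('f, 'r, 'm) struct \<Rightarrow> nat \<Rightarrow> 'm list monoid \<Rightarrow> 'm list set set \<Rightarrow> bool" where
  "uniformly_definable_subgroups L M d G F \<longleftrightarrow>
     (\<forall>H \<in> F. subgroup H G) \<and>
     (\<exists>q. \<exists>\<phi> \<in> fms L (d + q). \<forall>H \<in> F. \<exists>a \<in> tuples M q.
        H = {g \<in> carrier G. holds M \<phi> (g @ a)})"

(* The interpretation in N of the M-definable set D; by elementarity it does not depend on the
   choice of \<phi> and a. *)
definition ext ::
  "('f, 'r) language \<Rightarrow> ('f, 'r, 'm) struct \<Rightarrow> ('f, 'r, 'u) struct \<Rightarrow> ('m \<Rightarrow> 'u) \<Rightarrow> nat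
    \<Rightarrow> 'm list set \<Rightarrow> 'u list set" where
  "ext L M N e d D = {x. \<exists>q. \<exists>\<phi> \<in> fms L (d + q). \<exists>a \<in> tuples M q.
     D = defset M d \<phi> a \<and> x \<in> defset N d \<phi> (map e a)}"

definition ext_group ::
  "('f, 'r) language \<Rightarrow> ('f, 'r, 'm) struct \<Rightarrow> ('f, 'r, 'u) struct \<Rightarrow> ('m \<Rightarrow> 'u) \<Rightarrow> nat
    \<Rightarrow> 'm list monoid \<Rightarrow> 'u list monoid" where
  "ext_group L M N e d G =
     \<lparr>carrier = ext L M N e d (carrier G),
      mult = (\<lambda>x y. THE z. x @ y @ z \<in> ext L M N e (3 * d) (mult_graph G)),
      one = map e \<one>\<^bsub>G\<^esub>\<rparr>"

(* A type-definable set is given by a partial type over M, represented by the nonempty family of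
   M-definable sets that its formulas define.  In particular a family S of definable subgroups of G
   represents the type-definable group that is the intersection of S. *)
definition realizations ::
  "('f, 'r) language \<Rightarrow> ('f, 'r, 'm) struct \<Rightarrow> ('f, 'r, 'u) struct \<Rightarrow> ('m \<Rightarrow> 'u) \<Rightarrow> nat
    \<Rightarrow> 'm list set set \<Rightarrow> 'u list set" where
  "realizations L M N e d S = (\<Inter>D \<in> S. ext L M N e d D)"

(* Inclusion of type-definable sets, which is inclusion in every elementary superstructure, not
   just in M. *)
definition type_le ::
  "('f, 'r) language \<Rightarrow> ('f, 'r, 'm) struct \<Rightarrow> nat \<Rightarrow> 'm list set set \<Rightarrow> 'm list set set
    \<Rightarrow> 'u itself \<Rightarrow> bool" where
  "type_le L M d S R U \<longleftrightarrow>
     (\<forall>(N :: ('f, 'r, 'u) struct) e. elementary_ext L M N e \<longrightarrow>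
        realizations L M N e d S \<subseteq> realizations L M N e d R)"

definition cosets_in :: "'g monoid \<Rightarrow> 'g set \<Rightarrow> 'g set \<Rightarrow> 'g set set" where
  "cosets_in G K H = rcosets\<^bsub>G\<lparr>carrier := K\<rparr>\<^esub> H"

definition index_le :: "'g monoid \<Rightarrow> 'g set \<Rightarrow> 'g set \<Rightarrow> nat \<Rightarrow> bool" where
  "index_le G K H n \<longleftrightarrow> finite (cosets_in G K H) \<and> card (cosets_in G K H) \<le> n"

(* The type-definable group represented by S has bounded index in the one represented by R.  As
   with a monster model, a cardinal is small if it is less than that of 'u. *)
definition bounded_index ::
  "('f, 'r) language \<Rightarrow> ('f, 'r, 'm) struct \<Rightarrow> nat \<Rightarrow> 'm list monoid
    \<Rightarrow> 'm list set set \<Rightarrow> 'm list set set \<Rightarrow> 'u itself \<Rightarrow> bool" where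
  "bounded_index L M d G S R U \<longleftrightarrow>
     (\<exists>B :: 'u set. B \<prec> (UNIV :: 'u set) \<and>
       (\<forall>(N :: ('f, 'r, 'u) struct) e. elementary_ext L M N e \<longrightarrow>
          cosets_in (ext_group L M N e d G)
            (realizations L M N e d R) (realizations L M N e d S) \<lesssim> B))"

(* The union of two families represents the intersection of the two groups. *)
definition commensurable ::
  "('f, 'r) language \<Rightarrow> ('f, 'r, 'm) struct \<Rightarrow> nat \<Rightarrow> 'm list monoid
    \<Rightarrow> 'm list set set \<Rightarrow> 'm list set set \<Rightarrow> 'u itself \<Rightarrow> bool" where
  "commensurable L M d G S R U \<longleftrightarrow>
     bounded_index L M d G (S \<union> R) S U \<and> bounded_index L M d G (S \<union> R) R U"

end

theory Submission
  imports Defs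
begin

text \<open>Call \<open>H\<^sub>0, \<dots>, H\<^sub>n\<close> in the family an \<open>n\<close>-chain if \<open>H\<^sub>0 \<inter> \<dots> \<inter> H\<^sub>i\<^sub>+\<^sub>1\<close> has index greater than \<open>n\<close> in
  \<open>H\<^sub>0 \<inter> \<dots> \<inter> H\<^sub>i\<close> for all \<open>i < n\<close>.  Splitting cosets of \<open>H\<^sub>0 \<inter> \<dots> \<inter> H\<^sub>i\<close> into cosets of
  \<open>H\<^sub>0 \<inter> \<dots> \<inter> H\<^sub>i\<^sub>+\<^sub>1\<close> turns an \<open>n\<close>-chain into a tree of cosets of members of the family, of depth
  and width \<open>n\<close>, with pairwise disjoint siblings and consistent branches.  If there were \<open>n\<close>-chains
  for all \<open>n\<close>, an ultrapower would contain an infinite such tree, so that the formula for membership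
  in a coset would have the tree property.  Hence some \<open>n\<close> has no \<open>n\<close>-chain, and a greedily
  chosen subintersection of size at most \<open>n\<close> has index at most \<open>n\<close> over its intersection with any
  further member.  Finite indices persist in elementary extensions, and an intersection of boundedly
  many subgroups of finite index has bounded index.  For the last claim, an unbounded descent from an
  intersection to the next one yields, over every finite subintersection of the former, a
  member of the latter of infinite index, so a descending sequence of length above \<open>n\<close> gives an \<open>n\<close>-chain.\<close>

subsection \<open>Coincidence, renaming and block quantifiers\<close>

lemma finite_tm_vars [simp]: "finite (tm_vars t)"
  by (induction t) auto

lemma finite_free_vars [simp]: "finite (free_vars \<phi>)"
  by (induction \<phi>) auto

lemma eval_cong: "(\<And>v. v \<in> tm_vars t \<Longrightarrow> s v = s' v) \<Longrightarrow> eval M s t = eval M s' t"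
proof (induction t)
  case (App f ts)
  then have "map (eval M s) ts = map (eval M s') ts"
    by (auto intro!: map_cong)
  then show ?case by (simp del: map_eq_conv)
qed simp

lemma sat_cong: "(\<And>v. v \<in> free_vars \<phi> \<Longrightarrow> s v = s' v) \<Longrightarrow> sat M s \<phi> = sat M s' \<phi>"
proof (induction \<phi> arbitrary: s s')
  case (Eql t u)
  then have "eval M s t = eval M s' t" "eval M s u = eval M s' u"
    by (auto intro: eval_cong)
  then show ?case by simp
next
  case (Rel r ts)
  then have "map (eval M s) ts = map (eval M s') ts"
    by (auto intro!: map_cong eval_cong)
  then show ?case by (simp del: map_eq_conv)
next
  case (Ex i \<phi>)
  have "sat M (s(i := x)) \<phi> = sat M (s'(i := x)) \<phi>" for x
    by (rule Ex.IH) (use Ex.prems in auto)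
  then show ?case by simp
next
  case (Neg \<phi>)
  have "sat M s \<phi> = sat M s' \<phi>"
    by (rule Neg.IH) (use Neg.prems in auto)
  then show ?case by simp
next
  case (Conj \<phi> \<psi>)
  have "sat M s \<phi> = sat M s' \<phi>"
    by (rule Conj.IH) (use Conj.prems in auto)
  moreover have "sat M s \<psi> = sat M s' \<psi>"
    by (rule Conj.IH) (use Conj.prems in auto)
  ultimately show ?case by simp
qed

primrec ren_tm :: "(nat \<Rightarrow> nat) \<Rightarrow> 'f tm \<Rightarrow> 'f tm" where
  "ren_tm f (Var i) = Var (f i)"
| "ren_tm f (App g ts) = App g (map (ren_tm f) ts)"

text \<open>Capture is avoided by moving the bound variable above all images of free variables;
  inserting 0 keeps \<open>Max\<close> defined when there are none.\<close>

fun ren :: "(nat \<Rightarrow> nat) \<Rightarrow> ('f, 'r) fm \<Rightarrow> ('f, 'r) fm" where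
  "ren f (Eql t u) = Eql (ren_tm f t) (ren_tm f u)"
| "ren f (Rel r ts) = Rel r (map (ren_tm f) ts)"
| "ren f (Neg \<phi>) = Neg (ren f \<phi>)"
| "ren f (Conj \<phi> \<psi>) = Conj (ren f \<phi>) (ren f \<psi>)"
| "ren f (Ex i \<phi>) =
    (let j = Suc (Max (insert 0 (f ` free_vars \<phi>))) in Ex j (ren (f(i := j)) \<phi>))"

lemma tm_in_ren_tm [simp]: "tm_in L (ren_tm f t) = tm_in L t"
  by (induction t) auto

lemma fm_in_ren [simp]: "fm_in L (ren f \<phi>) = fm_in L \<phi>"
  by (induction \<phi> arbitrary: f) (auto simp: Let_def)

lemma tm_vars_ren_tm [simp]: "tm_vars (ren_tm f t) = f ` tm_vars t"
  by (induction t) auto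

lemma eval_ren_tm [simp]: "eval M s (ren_tm f t) = eval M (\<lambda>v. s (f v)) t"
proof (induction t)
  case (App g ts)
  then have "map (\<lambda>t. eval M s (ren_tm f t)) ts = map (eval M (\<lambda>v. s (f v))) ts"
    by (auto intro!: map_cong)
  then show ?case by (simp add: comp_def del: map_eq_conv)
qed simp

lemma free_vars_ren: "free_vars (ren f \<phi>) \<subseteq> f ` free_vars \<phi>"
proof (induction \<phi> arbitrary: f)
  case (Ex i \<phi>)
  then show ?case
    using Ex.IH[of "f(i := Suc (Max (insert 0 (f ` free_vars \<phi>)))) "]
    by (fastforce simp: Let_def split: if_splits)
qed fastforce+

lemma sat_ren [simp]: "sat M s (ren f \<phi>) = sat M (\<lambda>v. s (f v)) \<phi>"
proof (induction \<phi> arbitrary: f s)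
  case (Rel r ts)
  then show ?case by (simp add: comp_def)
next
  case (Ex i \<phi>)
  define j where "j = Suc (Max (insert 0 (f ` free_vars \<phi>)))"
  have j: "f v \<noteq> j" if "v \<in> free_vars \<phi>" for v
  proof -
    have "f v \<le> Max (insert 0 (f ` free_vars \<phi>))"
      using that by (intro Max_ge) auto
    then show ?thesis by (simp add: j_def)
  qed
  have "sat M (s(j := x)) (ren (f(i := j)) \<phi>) = sat M ((\<lambda>v. s (f v))(i := x)) \<phi>" for x
    unfolding Ex.IH by (rule sat_cong) (use j in auto)
  then show ?case by (simp add: j_def[symmetric] Let_def)
qed auto

primrec exs :: "nat \<Rightarrow> nat \<Rightarrow> ('f, 'r) fm \<Rightarrow> ('f, 'r) fm" where
  "exs 0 k \<phi> = \<phi>"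
| "exs (Suc n) k \<phi> = Ex k (exs n (Suc k) \<phi>)"

lemma fm_in_exs [simp]: "fm_in L (exs n k \<phi>) = fm_in L \<phi>"
  by (induction n arbitrary: k) auto

lemma free_vars_exs [simp]: "free_vars (exs n k \<phi>) = free_vars \<phi> - {k..<k + n}"
  by (induction n arbitrary: k) auto

lemma tuples_0 [simp]: "tuples M 0 = {[]}"
  by (auto simp: tuples_def)

lemma tuples_Suc: "tuples M (Suc n) = {x # xs | x xs. x \<in> univ M \<and> xs \<in> tuples M n}"
  by (auto simp: tuples_def length_Suc_conv)

lemma tuples_nth: "xs \<in> tuples M n \<Longrightarrow> i < n \<Longrightarrow> xs ! i \<in> univ M"
  by (auto simp: tuples_def dest: nth_mem)

lemma sat_exs:
  "sat M s (exs n k \<phi>) \<longleftrightarrow>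
    (\<exists>xs \<in> tuples M n. sat M (\<lambda>v. if k \<le> v \<and> v < k + n then xs ! (v - k) else s v) \<phi>)"
proof (induction n arbitrary: k s)
  case (Suc n)
  have "(\<lambda>v. if Suc k \<le> v \<and> v < Suc k + n then xs ! (v - Suc k) else (s(k := x)) v) =
      (\<lambda>v. if k \<le> v \<and> v < k + Suc n then (x # xs) ! (v - k) else s v)" for x xs
    by (rule ext) (auto simp: nth_Cons' Suc_diff_le)
  then show ?case
    by (simp only: exs.simps sat.simps Suc.IH) (auto simp: tuples_Suc Bex_def)
next
  case (0 k s)
  have "sat M (\<lambda>v. if k \<le> v \<and> v < k + 0 then xs ! (v - k) else s v) \<phi> = sat M s \<phi>" for xs
    by (rule sat_cong) auto
  then show ?case unfolding exs.simps by (simp only: tuples_0) simp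
qed

subsection \<open>Ultrapowers\<close>

text \<open>Zorn's lemma for the reversed order gives a minimal proper filter below
  \<open>F\<close>. The infimum of a chain stays proper since whatever it makes eventual is already
  eventual in some member of the chain.\<close>

lemma ultrafilter_exists:
  fixes F :: "'a filter"
  assumes "F \<noteq> bot"
  obtains U where "U \<le> F" "U \<noteq> bot" "\<And>P. eventually P U \<or> eventually (\<lambda>x. \<not> P x) U"
proof -
  let ?A = "{G. G \<le> F \<and> G \<noteq> bot}"
  have "\<exists>U\<in>?A. \<forall>G\<in>?A. U \<ge> G \<longrightarrow> G = U"
  proof (rule predicate_Zorn[where P = "\<lambda>x y. y \<le> x"])
    show "partial_order_on ?A (relation_of (\<lambda>x y. y \<le> x) ?A)"
      by (rule partial_order_on_relation_ofI) auto
    fix C assume "C \<in> Chains (relation_of (\<lambda>x y. y \<le> x) ?A)"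
    then have C: "C \<subseteq> ?A" "\<And>x y. x \<in> C \<Longrightarrow> y \<in> C \<Longrightarrow> x \<le> y \<or> y \<le> x"
      by (auto simp: Chains_def relation_of_def)
    show "\<exists>u\<in>?A. \<forall>G\<in>C. u \<le> G"
    proof (cases "C = {}")
      case True
      then show ?thesis using assms by auto
    next
      case False
      have "eventually P (Inf C) \<longleftrightarrow> (\<exists>b\<in>C. eventually P b)" for P
        by (rule eventually_Inf_base[OF False]) (metis C(2) inf.absorb1 inf.absorb2 le_refl)
      then have "Inf C \<noteq> bot"
        using C(1) by (auto simp: trivial_limit_def)
      moreover have "Inf C \<le> F"
        using False C(1) by (metis (no_types, lifting) Inf_lower2 ex_in_conv mem_Collect_eq subsetD)
      ultimately show ?thesis by (auto intro!: bexI[of _ "Inf C"] Inf_lower)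
    qed
  qed
  then obtain U where U: "U \<le> F" "U \<noteq> bot" and max: "\<And>G. G \<le> F \<Longrightarrow> G \<noteq> bot \<Longrightarrow> G \<le> U \<Longrightarrow> G = U"
    by auto
  have "eventually P U \<or> eventually (\<lambda>x. \<not> P x) U" for P
  proof (rule disjCI)
    assume "\<not> eventually (\<lambda>x. \<not> P x) U"
    \<comment> \<open>Adjoining \<open>{x. P x}\<close> keeps the filter proper, so by minimality
      the filter does not change.\<close>
    then have "inf U (principal {x. P x}) \<noteq> bot"
      by (simp add: trivial_limit_def eventually_inf_principal)
    then have "inf U (principal {x. P x}) = U"
      using U by (intro max) (auto intro: order_trans[OF inf_le1])
    then show "eventually P U"
      by (metis (mono_tags, lifting) eventually_inf_principal eventually_mono mem_Collect_eq always_eventually)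
  qed
  with U show thesis by (rule that)
qed

text \<open>The elements of the ultrapower are named in \<open>'u\<close>, because
  \<open>simple_theory\<close> speaks of structures on \<open>'u\<close>. The naming
  \<open>\<iota>\<close> identifies sequences exactly modulo \<open>U\<close>.\<close>

locale ultrapower =
  fixes L :: "('f, 'r) language" and M :: "('f, 'r, 'm) struct" and U :: "nat filter"
    and \<iota> :: "(nat \<Rightarrow> 'm) \<Rightarrow> 'u"
  assumes M: "is_structure L M"
    and U_nontriv: "U \<noteq> bot"
    and ultra: "\<And>P. eventually P U \<or> eventually (\<lambda>x. \<not> P x) U"
    and \<iota>_eq: "\<And>X Y. \<iota> X = \<iota> Y \<longleftrightarrow> (\<forall>\<^sub>F n in U. X n = Y n)"
begin

definition seqs :: "(nat \<Rightarrow> 'm) set" where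
  "seqs = {X. range X \<subseteq> univ M}"

text \<open>Since \<open>\<iota>\<close> is injective only modulo \<open>U\<close>, a representative
  has to be chosen; it agrees with a given sequence of the same class \<open>U\<close>-almost
  everywhere.\<close>

definition rep :: "'u \<Rightarrow> nat \<Rightarrow> 'm" where
  "rep u = (SOME X. X \<in> seqs \<and> \<iota> X = u)"

definition pow :: "('f, 'r, 'u) struct" where
  "pow = \<lparr>univ = \<iota> ` seqs,
          fn = (\<lambda>f us. \<iota> (\<lambda>n. fn M f (map (\<lambda>u. rep u n) us))),
          rel = (\<lambda>r us. \<forall>\<^sub>F n in U. rel M r (map (\<lambda>u. rep u n) us))\<rparr>"

lemma pow_simps:
  "univ pow = \<iota> ` seqs"
  "fn pow f us = \<iota> (\<lambda>n. fn M f (map (\<lambda>u. rep u n) us))"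
  "rel pow r us \<longleftrightarrow> (\<forall>\<^sub>F n in U. rel M r (map (\<lambda>u. rep u n) us))"
  by (simp_all add: pow_def)

lemma eventually_not: "(\<forall>\<^sub>F n in U. \<not> P n) \<longleftrightarrow> \<not> (\<forall>\<^sub>F n in U. P n)"
proof -
  have "\<not> ((\<forall>\<^sub>F n in U. \<not> P n) \<and> (\<forall>\<^sub>F n in U. P n))"
    using U_nontriv by (simp flip: eventually_conj_iff)
  then show ?thesis using ultra[of P] by blast
qed

lemma rep: "u \<in> \<iota> ` seqs \<Longrightarrow> rep u \<in> seqs \<and> \<iota> (rep u) = u"
  using someI_ex[of "\<lambda>X. X \<in> seqs \<and> \<iota> X = u"] by (auto simp: rep_def)

lemma rep_\<iota>: "X \<in> seqs \<Longrightarrow> rep (\<iota> X) \<in> seqs" "X \<in> seqs \<Longrightarrow> \<forall>\<^sub>F n in U. rep (\<iota> X) n = X n"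
proof -
  assume "X \<in> seqs"
  then have "rep (\<iota> X) \<in> seqs \<and> \<iota> (rep (\<iota> X)) = \<iota> X"
    by (intro rep) simp
  then show "rep (\<iota> X) \<in> seqs" "\<forall>\<^sub>F n in U. rep (\<iota> X) n = X n"
    using \<iota>_eq[of "rep (\<iota> X)" X] by blast+
qed

text \<open>A term has finitely many arguments, so the almost everywhere agreements of their
  representatives hold simultaneously.\<close>

lemma eventually_map_rep:
  assumes "\<And>t. t \<in> set ts \<Longrightarrow> g t \<in> seqs"
  shows "\<forall>\<^sub>F n in U. map (\<lambda>t. rep (\<iota> (g t)) n) ts = map (\<lambda>t. g t n) ts"
proof -
  have "\<forall>\<^sub>F n in U. \<forall>t \<in> set ts. rep (\<iota> (g t)) n = g t n"
    using assms rep_\<iota>(2) by (intro eventually_ball_finite) auto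
  then show ?thesis by (rule eventually_mono) auto
qed

lemma eval_seqs:
  assumes "\<And>v. \<sigma> v \<in> seqs" "tm_in L t"
  shows "(\<lambda>n. eval M (\<lambda>v. \<sigma> v n) t) \<in> seqs"
  using assms(2)
proof (induction t)
  case (Var x)
  then show ?case using assms(1) by simp
next
  case (App f ts)
  have "fn M f (map (eval M (\<lambda>v. \<sigma> v n)) ts) \<in> univ M" for n
  proof -
    have "map (eval M (\<lambda>v. \<sigma> v n)) ts \<in> tuples M (length ts)"
      using App by (auto simp: tuples_def seqs_def image_subset_iff)
    moreover have "(f, length ts) \<in> fst L" using App.prems by simp
    ultimately show ?thesis using M unfolding is_structure_def by blast
  qed
  then show ?case by (auto simp: seqs_def)
qed

lemma eval_pow:
  assumes "\<And>v. \<sigma> v \<in> seqs" "tm_in L t"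
  shows "eval pow (\<lambda>v. \<iota> (\<sigma> v)) t = \<iota> (\<lambda>n. eval M (\<lambda>v. \<sigma> v n) t)"
  using assms(2)
proof (induction t)
  case (App f ts)
  then have eq: "map (eval pow (\<lambda>v. \<iota> (\<sigma> v))) ts = map (\<lambda>t. \<iota> (\<lambda>n. eval M (\<lambda>v. \<sigma> v n) t)) ts"
    by (auto intro!: map_cong)
  have "\<forall>\<^sub>F n in U. map (\<lambda>t. rep (\<iota> (\<lambda>n. eval M (\<lambda>v. \<sigma> v n) t)) n) ts = map (\<lambda>t. eval M (\<lambda>v. \<sigma> v n) t) ts"
    using App.prems assms(1) by (intro eventually_map_rep eval_seqs) auto
  then have "\<forall>\<^sub>F n in U. fn M f (map (\<lambda>t. rep (\<iota> (\<lambda>n. eval M (\<lambda>v. \<sigma> v n) t)) n) ts) =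
      fn M f (map (\<lambda>t. eval M (\<lambda>v. \<sigma> v n) t) ts)"
    by (rule eventually_mono) (simp del: map_eq_conv)
  then show ?case
    by (simp only: eval.simps eq pow_simps \<iota>_eq map_map comp_def)
qed simp

text \<open>Induction on the formula: negation uses that \<open>U\<close> is an ultrafilter, and a
  quantifier is handled by choosing a witness at each index.\<close>

theorem Los:
  assumes "\<And>v. \<sigma> v \<in> seqs" "fm_in L \<phi>"
  shows "sat pow (\<lambda>v. \<iota> (\<sigma> v)) \<phi> \<longleftrightarrow> (\<forall>\<^sub>F n in U. sat M (\<lambda>v. \<sigma> v n) \<phi>)"
  using assms
proof (induction \<phi> arbitrary: \<sigma>)
  case (Eql t u)
  then show ?case by (simp add: eval_pow \<iota>_eq)
next
  case (Rel r ts)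
  have eq: "map (eval pow (\<lambda>v. \<iota> (\<sigma> v))) ts = map (\<lambda>t. \<iota> (\<lambda>n. eval M (\<lambda>v. \<sigma> v n) t)) ts"
    using Rel.prems by (auto intro!: map_cong eval_pow)
  have "\<forall>\<^sub>F n in U. map (\<lambda>t. rep (\<iota> (\<lambda>n. eval M (\<lambda>v. \<sigma> v n) t)) n) ts = map (\<lambda>t. eval M (\<lambda>v. \<sigma> v n) t) ts"
    using Rel.prems by (intro eventually_map_rep eval_seqs) auto
  then have "\<forall>\<^sub>F n in U. rel M r (map (\<lambda>t. rep (\<iota> (\<lambda>n. eval M (\<lambda>v. \<sigma> v n) t)) n) ts) =
      rel M r (map (\<lambda>t. eval M (\<lambda>v. \<sigma> v n) t) ts)"
    by (rule eventually_mono) (simp del: map_eq_conv)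
  then have "(\<forall>\<^sub>F n in U. rel M r (map (\<lambda>t. rep (\<iota> (\<lambda>n. eval M (\<lambda>v. \<sigma> v n) t)) n) ts)) =
      (\<forall>\<^sub>F n in U. rel M r (map (\<lambda>t. eval M (\<lambda>v. \<sigma> v n) t) ts))"
    by (rule eventually_subst)
  then show ?case
    by (simp only: sat.simps eq pow_simps map_map comp_def)
next
  case (Neg \<phi>)
  then show ?case by (simp add: eventually_not)
next
  case (Conj \<phi> \<psi>)
  then show ?case by (simp add: eventually_conj_iff)
next
  case (Ex i \<phi>)
  have IH: "sat pow ((\<lambda>v. \<iota> (\<sigma> v))(i := \<iota> X)) \<phi> \<longleftrightarrow>
      (\<forall>\<^sub>F n in U. sat M ((\<lambda>v. \<sigma> v n)(i := X n)) \<phi>)" if "X \<in> seqs" for X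
  proof -
    have "(\<lambda>v. \<iota> ((\<sigma>(i := X)) v)) = (\<lambda>v. \<iota> (\<sigma> v))(i := \<iota> X)"
      "(\<lambda>v. (\<sigma>(i := X)) v n) = (\<lambda>v. \<sigma> v n)(i := X n)" for n by auto
    then show ?thesis using Ex.IH[of "\<sigma>(i := X)"] Ex.prems that by auto
  qed
  have "(\<exists>X \<in> seqs. \<forall>\<^sub>F n in U. sat M ((\<lambda>v. \<sigma> v n)(i := X n)) \<phi>) \<longleftrightarrow>
      (\<forall>\<^sub>F n in U. \<exists>x \<in> univ M. sat M ((\<lambda>v. \<sigma> v n)(i := x)) \<phi>)" (is "?l \<longleftrightarrow> ?r")
  proof
    assume ?l
    then show ?r by (auto simp: seqs_def elim!: eventually_mono)
  next
    assume ?r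
    \<comment> \<open>A witness where there is one and an arbitrary element elsewhere, so that
      \<open>X\<close> lies in \<open>seqs\<close>.\<close>
    define X where "X n = (if \<exists>x \<in> univ M. sat M ((\<lambda>v. \<sigma> v n)(i := x)) \<phi>
      then SOME x. x \<in> univ M \<and> sat M ((\<lambda>v. \<sigma> v n)(i := x)) \<phi> else SOME x. x \<in> univ M)" for n
    have X: "X n \<in> univ M \<and> sat M ((\<lambda>v. \<sigma> v n)(i := X n)) \<phi>"
      if "\<exists>x \<in> univ M. sat M ((\<lambda>v. \<sigma> v n)(i := x)) \<phi>" for n
      unfolding X_def if_P[OF that]
      using someI_ex[of "\<lambda>x. x \<in> univ M \<and> sat M ((\<lambda>v. \<sigma> v n)(i := x)) \<phi>"] that by blast
    have "X n \<in> univ M" for n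
    proof (cases "\<exists>x \<in> univ M. sat M ((\<lambda>v. \<sigma> v n)(i := x)) \<phi>")
      case False
      then show ?thesis using M unfolding X_def if_not_P[OF False]
        by (simp add: is_structure_def some_in_eq)
    qed (use X in blast)
    then have "X \<in> seqs" by (auto simp: seqs_def)
    moreover have "\<forall>\<^sub>F n in U. sat M ((\<lambda>v. \<sigma> v n)(i := X n)) \<phi>"
      using \<open>?r\<close> by (rule eventually_mono) (use X in blast)
    ultimately show ?l by blast
  qed
  then show ?case using IH by (simp add: pow_simps)
qed

lemma holds_pow:
  assumes "\<phi> \<in> fms L (length Xs)" "set Xs \<subseteq> seqs"
  shows "holds pow \<phi> (map \<iota> Xs) \<longleftrightarrow> (\<forall>\<^sub>F n in U. holds M \<phi> (map (\<lambda>X. X n) Xs))"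
proof -
  obtain u where u: "u \<in> univ M" using M by (auto simp: is_structure_def)
  \<comment> \<open>Variables past the tuple are not free in \<open>\<phi>\<close>; a constant
    sequence fills them, as \<open>Los\<close> asks for a member of \<open>seqs\<close> at every
    variable.\<close>
  define \<sigma> where "\<sigma> v = (if v < length Xs then Xs ! v else (\<lambda>_. u))" for v
  have \<sigma>: "\<sigma> v \<in> seqs" for v
    using assms(2) u by (auto simp: \<sigma>_def seqs_def dest: nth_mem)
  have fv: "v \<in> free_vars \<phi> \<Longrightarrow> v < length Xs" for v
    using assms(1) by (auto simp: fms_def)
  have "holds pow \<phi> (map \<iota> Xs) \<longleftrightarrow> sat pow (\<lambda>v. \<iota> (\<sigma> v)) \<phi>"
    unfolding holds_def by (rule sat_cong) (auto simp: \<sigma>_def dest: fv)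
  also have "\<dots> \<longleftrightarrow> (\<forall>\<^sub>F n in U. sat M (\<lambda>v. \<sigma> v n) \<phi>)"
    using assms(1) \<sigma> by (intro Los) (auto simp: fms_def)
  also have "(\<lambda>n. sat M (\<lambda>v. \<sigma> v n) \<phi>) = (\<lambda>n. holds M \<phi> (map (\<lambda>X. X n) Xs))"
    unfolding holds_def by (intro HOL.ext sat_cong) (auto simp: \<sigma>_def dest: fv)
  finally show ?thesis .
qed

lemma tuples_pow: "xs \<in> tuples pow p \<longleftrightarrow> (\<exists>Xs. length Xs = p \<and> set Xs \<subseteq> seqs \<and> xs = map \<iota> Xs)"
proof
  assume xs: "xs \<in> tuples pow p"
  then show "\<exists>Xs. length Xs = p \<and> set Xs \<subseteq> seqs \<and> xs = map \<iota> Xs"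
    using xs rep by (intro exI[of _ "map rep xs"])
      (fastforce simp: tuples_def pow_simps intro!: map_idI[symmetric])
next
  assume "\<exists>Xs. length Xs = p \<and> set Xs \<subseteq> seqs \<and> xs = map \<iota> Xs"
  then show "xs \<in> tuples pow p" by (auto simp: tuples_def pow_simps subset_iff)
qed

lemma models_pow:
  assumes "models L M T" "T \<subseteq> fms L 0"
  shows "models L pow T"
proof -
  have "is_structure L pow"
    unfolding is_structure_def
  proof (intro conjI ballI)
    show "univ pow \<noteq> {}"
      using M by (auto simp: pow_simps is_structure_def seqs_def)
    fix g assume g: "g \<in> fst L"
    obtain f p where fp: "g = (f, p)" by (cases g)
    have "fn pow f us \<in> univ pow" if us: "us \<in> tuples pow p" for us
    proof -
      obtain Xs where Xs: "length Xs = p" "set Xs \<subseteq> seqs" "us = map \<iota> Xs"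
        using us by (auto simp: tuples_pow)
      have "map (\<lambda>u. rep u n) us \<in> tuples M p" for n
      proof -
        have "rep (\<iota> X) n \<in> univ M" if "X \<in> set Xs" for X
          using rep_\<iota>(1)[of X] that Xs(2) by (auto simp: seqs_def)
        then show ?thesis using Xs(1,3) by (auto simp: tuples_def)
      qed
      then have "fn M f (map (\<lambda>u. rep u n) us) \<in> univ M" for n
        using M g fp by (auto simp: is_structure_def)
      then show ?thesis by (auto simp: pow_simps seqs_def)
    qed
    then show "case g of (f, p) \<Rightarrow> \<forall>us \<in> tuples pow p. fn pow f us \<in> univ pow"
      by (simp add: fp)
  qed
  moreover have "holds pow \<phi> []" if "\<phi> \<in> T" for \<phi>
    using holds_pow[of \<phi> "[]"] assms that by (auto simp: models_def)
  ultimately show ?thesis by (simp add: models_def)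
qed

end

subsection \<open>Finite trees and the tree property\<close>

text \<open>A node of the infinite tree carries the classes of the sequences of its parameters in
  the given trees. Each condition in \<open>tree_property\<close> concerns finitely many nodes,
  which lie in the \<open>n\<close>-th tree for all large \<open>n\<close>, so Los's theorem carries
  it over.\<close>

lemma simple_no_finite_trees:
  fixes L :: "('f, 'r) language" and M :: "('f, 'r, 'm) struct"
  assumes large: "(UNIV :: (('f, 'r) fm \<times> 'm list) set set) \<prec> (UNIV :: 'u set)"
    and simple: "simple_theory L T TYPE('u)"
    and model: "models L M T"
    and \<psi>: "\<psi> \<in> fms L (p + q)"
    and trees: "\<And>n. \<exists>a :: nat list \<Rightarrow> 'm list. (\<forall>s. a s \<in> tuples M q) \<and>
      (\<forall>s i j. length s < n \<and> set (s @ [i, j]) \<subseteq> {..<n} \<and> i \<noteq> j \<longrightarrow>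
         \<not> (\<exists>x \<in> tuples M p. holds M \<psi> (x @ a (s @ [i])) \<and> holds M \<psi> (x @ a (s @ [j])))) \<and>
      (\<forall>s. length s \<le> n \<and> set s \<subseteq> {..<n} \<longrightarrow>
         (\<exists>x \<in> tuples M p. \<forall>m \<le> length s. holds M \<psi> (x @ a (take m s))))"
  shows False
proof -
  \<comment> \<open>\<open>U\<close> refines the cofinite filter, so what holds for all large
    \<open>n\<close> holds \<open>U\<close>-almost everywhere.\<close>
  obtain U :: "nat filter" where U: "U \<le> sequentially" "U \<noteq> bot"
    "\<And>P. eventually P U \<or> eventually (\<lambda>x. \<not> P x) U"
    using ultrafilter_exists[OF sequentially_bot] by blast
  obtain j :: "(('f, 'r) fm \<times> 'm list) set \<Rightarrow> 'u" where j: "inj j"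
    using large by (auto simp: lesspoll_def lepoll_def)
  \<comment> \<open>The ultrapower of \<open>M\<close> over the natural numbers has at most as many elements as there are sets
    of pairs of a formula and a tuple, so it can be carried by \<open>'u\<close>; the formula only tags the index.\<close>
  define code :: "(nat \<Rightarrow> 'm) \<Rightarrow> (('f, 'r) fm \<times> 'm list) set" where
    "code X = range (\<lambda>n. (Eql (Var n) (Var 0), [X n]))" for X
  have "inj code"
  proof (rule injI)
    fix X Y assume "code X = code Y"
    then have "(Eql (Var n) (Var 0), [X n]) \<in> code Y" for n by (auto simp: code_def)
    then show "X = Y" by (auto simp: code_def)
  qed
  \<comment> \<open>Equivalent sequences satisfy the same predicate inside \<open>SOME\<close>, so
    the chosen \<open>Y\<close> depends on the class only.\<close>
  define \<iota> where "\<iota> X = j (code (SOME Y. \<forall>\<^sub>F n in U. X n = Y n))" for X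
  have \<iota>: "\<iota> X = \<iota> Y \<longleftrightarrow> (\<forall>\<^sub>F n in U. X n = Y n)" for X Y
  proof
    have *: "\<forall>\<^sub>F n in U. X n = (SOME Y. \<forall>\<^sub>F n in U. X n = Y n) n"
      for X :: "nat \<Rightarrow> 'm"
      by (rule someI[of "\<lambda>Y. \<forall>\<^sub>F n in U. X n = Y n" X]) simp
    assume "\<iota> X = \<iota> Y"
    then have "(SOME Z. \<forall>\<^sub>F n in U. X n = Z n) = (SOME Z. \<forall>\<^sub>F n in U. Y n = Z n)"
      unfolding \<iota>_def by (rule injD[OF \<open>inj code\<close>, OF injD[OF j]])
    then have "\<forall>\<^sub>F n in U. Y n = (SOME Z. \<forall>\<^sub>F n in U. X n = Z n) n"
      using *[of Y] by simp
    with *[of X] show "\<forall>\<^sub>F n in U. X n = Y n"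
      by (rule eventually_elim2) simp
  next
    assume "\<forall>\<^sub>F n in U. X n = Y n"
    then have "\<forall>\<^sub>F n in U. (X n = Z n) = (Y n = Z n)" for Z
      by (rule eventually_mono) simp
    then have "(\<forall>\<^sub>F n in U. X n = Z n) \<longleftrightarrow> (\<forall>\<^sub>F n in U. Y n = Z n)" for Z
      by (rule eventually_subst)
    then show "\<iota> X = \<iota> Y" by (simp add: \<iota>_def)
  qed
  interpret ultrapower L M U \<iota>
    using model U(2,3) \<iota> by unfold_locales (auto simp: models_def)
  obtain a :: "nat \<Rightarrow> nat list \<Rightarrow> 'm list" where a: "\<And>n s. a n s \<in> tuples M q"
    and siblings: "\<And>n s i j. length s < n \<Longrightarrow> set (s @ [i, j]) \<subseteq> {..<n} \<Longrightarrow> i \<noteq> j \<Longrightarrow>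
         \<not> (\<exists>x \<in> tuples M p. holds M \<psi> (x @ a n (s @ [i])) \<and> holds M \<psi> (x @ a n (s @ [j])))"
    and branch: "\<And>n s. length s \<le> n \<Longrightarrow> set s \<subseteq> {..<n} \<Longrightarrow>
         \<exists>x \<in> tuples M p. \<forall>m \<le> length s. holds M \<psi> (x @ a n (take m s))"
  proof -
    have "\<exists>a. \<forall>n. (\<forall>s. a n s \<in> tuples M q) \<and>
      (\<forall>s i j. length s < n \<and> set (s @ [i, j]) \<subseteq> {..<n} \<and> i \<noteq> j \<longrightarrow>
         \<not> (\<exists>x \<in> tuples M p. holds M \<psi> (x @ a n (s @ [i])) \<and> holds M \<psi> (x @ a n (s @ [j])))) \<and>
      (\<forall>s. length s \<le> n \<and> set s \<subseteq> {..<n} \<longrightarrow>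
         (\<exists>x \<in> tuples M p. \<forall>m \<le> length s. holds M \<psi> (x @ a n (take m s))))"
      by (rule choice) (use trees in blast)
    then show thesis using that by metis
  qed
  \<comment> \<open>The \<open>q\<close> coordinate sequences of the parameters at the node
    \<open>s\<close>.\<close>
  define A where "A s = map (\<lambda>l n. a n s ! l) [0..<q]" for s
  have A_nth: "map (\<lambda>X. X n) (A s) = a n s" for n s
    using a[of n s] by (auto simp: A_def tuples_def intro!: nth_equalityI)
  have A_seqs: "set (A s) \<subseteq> seqs" for s
    by (auto simp: A_def seqs_def intro: tuples_nth[OF a])
  have len_A: "length (A s) = q" for s by (simp add: A_def)
  have holds_iff: "holds pow \<psi> (map \<iota> Xs @ map \<iota> (A s)) \<longleftrightarrow>
      (\<forall>\<^sub>F n in U. holds M \<psi> (map (\<lambda>X. X n) Xs @ a n s))"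
    if "length Xs = p" "set Xs \<subseteq> seqs" for Xs s
    using holds_pow[of \<psi> "Xs @ A s"] \<psi> that A_seqs[of s] by (simp add: len_A A_nth)
  have large_index: "\<forall>\<^sub>F n in U. length s \<le> n \<and> set s \<subseteq> {..<n}" for s :: "nat list"
  proof (rule filter_leD[OF U(1)])
    have "\<forall>\<^sub>F n in sequentially. \<forall>i \<in> insert (length s) (set s). i < n"
      by (intro eventually_ball_finite) (auto intro: eventually_gt_at_top)
    then show "\<forall>\<^sub>F n in sequentially. length s \<le> n \<and> set s \<subseteq> {..<n}"
      by (rule eventually_mono) auto
  qed
  have "tree_property pow \<psi> p q"
    unfolding tree_property_def
  \<comment> \<open>Siblings are pairwise inconsistent, which is the case \<open>k = 2\<close> of
    the tree property.\<close>
  proof (intro exI[of _ 2] conjI exI[of _ "\<lambda>s. map \<iota> (A s)"] allI impI)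
    show "map \<iota> (A s) \<in> tuples pow q" for s
      using A_seqs len_A by (auto simp: tuples_pow)
    fix s and I :: "nat set" assume "finite I \<and> card I = 2"
    then obtain i k where ik: "I = {i, k}" "i \<noteq> k" by (auto simp: card_2_iff)
    show "\<not> (\<exists>x \<in> tuples pow p. \<forall>i \<in> I. holds pow \<psi> (x @ map \<iota> (A (s @ [i]))))"
    proof
      assume "\<exists>x \<in> tuples pow p. \<forall>i \<in> I. holds pow \<psi> (x @ map \<iota> (A (s @ [i])))"
      then obtain Xs where Xs: "length Xs = p" "set Xs \<subseteq> seqs"
        and "holds pow \<psi> (map \<iota> Xs @ map \<iota> (A (s @ [i])))"
            "holds pow \<psi> (map \<iota> Xs @ map \<iota> (A (s @ [k])))"
        by (auto simp: ik tuples_pow)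
      then have "\<forall>\<^sub>F n in U. holds M \<psi> (map (\<lambda>X. X n) Xs @ a n (s @ [i])) \<and>
          holds M \<psi> (map (\<lambda>X. X n) Xs @ a n (s @ [k])) \<and>
          length (s @ [i, k]) \<le> n \<and> set (s @ [i, k]) \<subseteq> {..<n}"
        using large_index[of "s @ [i, k]"] by (simp add: holds_iff eventually_conj_iff)
      then obtain n where "holds M \<psi> (map (\<lambda>X. X n) Xs @ a n (s @ [i]))"
          "holds M \<psi> (map (\<lambda>X. X n) Xs @ a n (s @ [k]))"
          "length s < n" "set (s @ [i, k]) \<subseteq> {..<n}"
        using eventually_happens[of _ U] U(2) by fastforce
      moreover have "map (\<lambda>X. X n) Xs \<in> tuples M p"
        using Xs by (auto simp: tuples_def seqs_def)
      ultimately show False using siblings ik(2) by blast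
    qed
  next
    fix \<sigma> :: "nat \<Rightarrow> nat" and n0
    define s where "s = map \<sigma> [0..<n0]"
    obtain u where u: "u \<in> univ M" using M by (auto simp: is_structure_def)
    \<comment> \<open>For the finitely many \<open>n\<close> whose tree is too small to contain
      \<open>s\<close>, any tuple serves.\<close>
    have "\<forall>n. \<exists>x. x \<in> tuples M p \<and> (length s \<le> n \<and> set s \<subseteq> {..<n} \<longrightarrow>
        (\<forall>m \<le> length s. holds M \<psi> (x @ a n (take m s))))"
    proof
      fix n
      show "\<exists>x. x \<in> tuples M p \<and> (length s \<le> n \<and> set s \<subseteq> {..<n} \<longrightarrow>
        (\<forall>m \<le> length s. holds M \<psi> (x @ a n (take m s))))"
      proof (cases "length s \<le> n \<and> set s \<subseteq> {..<n}")
        case True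
        then show ?thesis using branch[of s n] by blast
      next
        case False
        then show ?thesis using u by (intro exI[of _ "replicate p u"]) (auto simp: tuples_def)
      qed
    qed
    then obtain x where x: "\<And>n. x n \<in> tuples M p"
      and holds_x: "\<And>n m. length s \<le> n \<Longrightarrow> set s \<subseteq> {..<n} \<Longrightarrow> m \<le> length s \<Longrightarrow>
          holds M \<psi> (x n @ a n (take m s))"
      by metis
    define Xs where "Xs = map (\<lambda>l n. x n ! l) [0..<p]"
    have Xs: "length Xs = p" "set Xs \<subseteq> seqs"
      by (auto simp: Xs_def seqs_def intro: tuples_nth[OF x])
    have Xs_nth: "map (\<lambda>X. X n) Xs = x n" for n
      using x[of n] by (auto simp: Xs_def tuples_def intro!: nth_equalityI)
    have "holds pow \<psi> (map \<iota> Xs @ map \<iota> (A (map \<sigma> [0..<m])))" if "m \<le> n0" for m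
    proof -
      have "map \<sigma> [0..<m] = take m s" using that by (simp add: s_def take_map)
      moreover have "m \<le> length s" using that by (simp add: s_def)
      ultimately show ?thesis
        using large_index[of s] unfolding holds_iff[OF Xs]
        by (auto simp: Xs_nth holds_x elim!: eventually_mono)
    qed
    then show "\<exists>x \<in> tuples pow p. \<forall>m \<le> n0. holds pow \<psi> (x @ map \<iota> (A (map \<sigma> [0..<m])))"
      using Xs by (intro bexI[of _ "map \<iota> Xs"]) (auto simp: tuples_pow)
  qed simp
  moreover have "models L pow T"
    using models_pow[OF model] simple by (simp add: simple_theory_def)
  ultimately show False
    using simple \<psi> by (auto simp: simple_theory_def)
qed

subsection \<open>Cosets\<close>

text \<open>A coset depends on the multiplication alone, so restricting the carrier to
  \<open>K\<close> only restricts the representatives.\<close>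

lemma cosets_in_eq: "cosets_in G K H = (\<lambda>a. H #>\<^bsub>G\<^esub> a) ` K"
  by (auto simp: cosets_in_def RCOSETS_def r_coset_def)

lemma (in group) rcos_eqI:
  assumes "subgroup H G" "a \<in> carrier G" "b \<in> carrier G" "a \<otimes> inv b \<in> H"
  shows "H #> a = H #> b"
proof -
  have "a = (a \<otimes> inv b) \<otimes> b" using assms by (simp add: m_assoc)
  then have "a \<in> H #> b" using assms by (auto simp: r_coset_def)
  then show ?thesis using repr_independence[OF _ assms(3,1)] by simp
qed

text \<open>Elements of \<open>K\<close> that are distinct modulo \<open>K \<inter> H\<close> are
  distinct modulo \<open>H\<close>. Hence siblings in the tree can be cosets of the family member
  \<open>H\<close> itself, which one formula defines uniformly.\<close>

lemma many_cosets:
  fixes G :: "'a monoid" (structure)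
  assumes "group G" "subgroup K G" "subgroup H G" "\<not> index_le G K (K \<inter> H) n"
  obtains h :: "nat \<Rightarrow> 'a" where "\<And>i. i < n \<Longrightarrow> h i \<in> K"
    "\<And>i j. i < n \<Longrightarrow> j < n \<Longrightarrow> i \<noteq> j \<Longrightarrow> h i \<otimes> inv (h j) \<notin> H"
proof -
  interpret group G by fact
  let ?C = "(\<lambda>a. (K \<inter> H) #> a) ` K"
  have "infinite ?C \<or> n \<le> card ?C"
    using assms(4) by (auto simp: index_le_def cosets_in_eq)
  then obtain D where D: "D \<subseteq> ?C" "finite D" "card D = n"
    using infinite_arbitrarily_large obtain_subset_with_card_n by metis
  obtain c where c: "bij_betw c {0..<n} D"
    using ex_bij_betw_nat_finite[OF D(2)] D(3) by auto
  have "\<forall>i. \<exists>h. i < n \<longrightarrow> h \<in> K \<and> c i = (K \<inter> H) #> h"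
  proof
    fix i
    show "\<exists>h. i < n \<longrightarrow> h \<in> K \<and> c i = (K \<inter> H) #> h"
    proof (cases "i < n")
      case True
      then have "c i \<in> ?C" using bij_betwE[OF c] D(1) by auto
      then show ?thesis by auto
    qed simp
  qed
  then obtain h where h: "\<And>i. i < n \<Longrightarrow> h i \<in> K" "\<And>i. i < n \<Longrightarrow> c i = (K \<inter> H) #> h i"
    by metis
  show thesis
  proof (rule that[of h])
    show "h i \<in> K" if "i < n" for i using that by (rule h)
    fix i j assume ij: "i < n" "j < n" "i \<noteq> j"
    show "h i \<otimes> inv (h j) \<notin> H"
    proof
      assume "h i \<otimes> inv (h j) \<in> H"
      moreover have "h i \<otimes> inv (h j) \<in> K"
        using ij h(1) assms(2) by (simp add: subgroup.m_closed subgroup.m_inv_closed)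
      ultimately have "(K \<inter> H) #> h i = (K \<inter> H) #> h j"
        using ij h(1) assms(2,3)
        by (intro rcos_eqI) (auto intro: subgroups_Inter_pair subgroup.mem_carrier)
      then show False
        using ij c h(2) by (auto simp: bij_betw_def inj_on_def)
    qed
  qed
qed

text \<open>The element reached from the root of the tree of cosets along the branch \<open>\<sigma>\<close>.\<close>

primrec walk :: "('a, 'b) monoid_scheme \<Rightarrow> (nat \<Rightarrow> nat \<Rightarrow> 'a) \<Rightarrow> (nat \<Rightarrow> nat) \<Rightarrow> nat \<Rightarrow> 'a" where
  "walk G h \<sigma> 0 = \<one>\<^bsub>G\<^esub>"
| "walk G h \<sigma> (Suc m) = h m (\<sigma> m) \<otimes>\<^bsub>G\<^esub> walk G h \<sigma> m"

lemma walk_cong: "(\<And>i. i < m \<Longrightarrow> \<sigma> i = \<tau> i) \<Longrightarrow> walk G h \<sigma> m = walk G h \<tau> m"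
  by (induction m) auto

section \<open>Definability of cosets\<close>

lemma definable_subset: "definable L M d D \<Longrightarrow> D \<subseteq> tuples M d"
  by (auto simp: definable_def defset_def)

text \<open>Elements of the carrier have length \<open>d\<close>, so a concatenation splits into its
  three parts in one way only.\<close>

lemma mem_mult_graph:
  assumes "carrier G \<subseteq> tuples M d" "x \<in> tuples M d" "y \<in> tuples M d" "z \<in> tuples M d"
  shows "x @ y @ z \<in> mult_graph G \<longleftrightarrow> x \<in> carrier G \<and> y \<in> carrier G \<and> z = x \<otimes>\<^bsub>G\<^esub> y"
proof
  assume "x @ y @ z \<in> mult_graph G"
  then obtain x' y' where "x' \<in> carrier G" "y' \<in> carrier G" "x @ y @ z = x' @ y' @ (x' \<otimes>\<^bsub>G\<^esub> y')"
    by (auto simp: mult_graph_def)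
  moreover from this have "length x' = length x" "length y' = length y"
    using assms by (auto simp: tuples_def subset_iff)
  ultimately show "x \<in> carrier G \<and> y \<in> carrier G \<and> z = x \<otimes>\<^bsub>G\<^esub> y" by auto
qed (auto simp: mult_graph_def)

text \<open>The formula with variables \<open>x, y, z, b\<close> saying that \<open>x\<close> lies in the right coset of \<open>y\<close> with
  respect to the subgroup defined by \<open>\<phi>\<close> with parameters \<open>z\<close>, where \<open>\<mu>\<close> with parameters \<open>b\<close>
  defines the graph of multiplication.\<close>

definition coset_fm ::
  "nat \<Rightarrow> nat \<Rightarrow> nat \<Rightarrow> ('f, 'r) fm \<Rightarrow> ('f, 'r) fm \<Rightarrow> ('f, 'r) fm" where
  "coset_fm d q r \<mu> \<phi> = (let k = 2 * d + q + r in
     exs d k (Conj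
       (ren (\<lambda>v. if v < d then k + v else if v < 2 * d then v
               else if v < 3 * d then v - 2 * d else v - d + q) \<mu>)
       (ren (\<lambda>v. if v < d then k + v else v + d) \<phi>)))"

lemma coset_fm_in:
  assumes "\<mu> \<in> fms L (3 * d + r)" "\<phi> \<in> fms L (d + q)"
  shows "coset_fm d q r \<mu> \<phi> \<in> fms L (d + (d + q + r))"
  using assms
    free_vars_ren[of "\<lambda>v. if v < d then 2 * d + q + r + v else if v < 2 * d then v
               else if v < 3 * d then v - 2 * d else v - d + q" \<mu>]
    free_vars_ren[of "\<lambda>v. if v < d then 2 * d + q + r + v else v + d" \<phi>]
  by (fastforce simp: fms_def coset_fm_def Let_def subset_iff split: if_splits)

text \<open>The quantified block \<open>w\<close> starts at variable \<open>2 * d + q + r\<close>,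
  behind \<open>x\<close>, \<open>y\<close>, \<open>z\<close>, \<open>b\<close>. The first renaming
  reads \<open>\<mu>\<close> at \<open>w\<close>, \<open>y\<close>, \<open>x\<close>,
  \<open>b\<close>, as \<open>x\<close> is to be the product of \<open>w\<close> and
  \<open>y\<close>; the second reads \<open>\<phi>\<close> at \<open>w\<close>,
  \<open>z\<close>.\<close>

lemma holds_coset_fm:
  assumes "\<mu> \<in> fms L (3 * d + r)" "\<phi> \<in> fms L (d + q)"
    and "x \<in> tuples M d" "y \<in> tuples M d" "z \<in> tuples M q" "b \<in> tuples M r"
  shows "holds M (coset_fm d q r \<mu> \<phi>) (x @ y @ z @ b) \<longleftrightarrow>
    (\<exists>w \<in> tuples M d. holds M \<mu> (w @ y @ x @ b) \<and> holds M \<phi> (w @ z))"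
proof -
  let ?k = "2 * d + q + r"
  let ?f = "\<lambda>v. if v < d then ?k + v else if v < 2 * d then v
               else if v < 3 * d then v - 2 * d else v - d + q"
  let ?g = "\<lambda>v. if v < d then ?k + v else v + d"
  let ?s = "\<lambda>w v. if ?k \<le> v \<and> v < ?k + d then w ! (v - ?k) else (x @ y @ z @ b) ! v"
  have len: "length x = d" "length y = d" "length z = q" "length b = r"
    using assms by (auto simp: tuples_def)
  have \<mu>: "sat M (\<lambda>v. ?s w (?f v)) \<mu> = holds M \<mu> (w @ y @ x @ b)" if "w \<in> tuples M d" for w
    unfolding holds_def
  proof (rule sat_cong)
    fix v assume "v \<in> free_vars \<mu>"
    then have "v < 3 * d + r" using assms(1) by (auto simp: fms_def)
    then consider "v < d" | i where "i < d" "v = d + i" | i where "i < d" "v = d + (d + i)"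
      | i where "i < r" "v = d + (d + (d + i))"
      by (metis add.assoc add_less_cancel_left le_Suc_ex linorder_not_le mult_2 numeral_3_eq_3 mult_Suc
            numeral_2_eq_2)
    moreover have "length w = d" using that by (simp add: tuples_def)
    ultimately show "?s w (?f v) = (w @ y @ x @ b) ! v"
      by cases (simp_all add: nth_append len)
  qed
  have \<phi>: "sat M (\<lambda>v. ?s w (?g v)) \<phi> = holds M \<phi> (w @ z)" if "w \<in> tuples M d" for w
    unfolding holds_def
  proof (rule sat_cong)
    fix v assume "v \<in> free_vars \<phi>"
    then have "v < d + q" using assms(2) by (auto simp: fms_def)
    then consider "v < d" | i where "i < q" "v = d + i"
      by (metis add_less_cancel_left le_Suc_ex linorder_not_le)
    moreover have "length w = d" using that by (simp add: tuples_def)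
    ultimately show "?s w (?g v) = (w @ z) ! v"
      by cases (simp_all add: nth_append len)
  qed
  have "holds M (coset_fm d q r \<mu> \<phi>) (x @ y @ z @ b) \<longleftrightarrow>
      sat M (\<lambda>v. (x @ y @ z @ b) ! v) (coset_fm d q r \<mu> \<phi>)"
    by (rule holds_def)
  also have "\<dots> \<longleftrightarrow> (\<exists>w \<in> tuples M d. sat M (\<lambda>v. ?s w (?f v)) \<mu> \<and> sat M (\<lambda>v. ?s w (?g v)) \<phi>)"
    by (simp only: coset_fm_def Let_def sat_exs sat.simps sat_ren)
  finally show ?thesis by (simp only: \<mu> \<phi> cong: bex_cong)
qed

section \<open>From chains of subgroups to trees of cosets\<close>

lemma (in group) subgroup_INT:
  "I \<noteq> {} \<Longrightarrow> (\<And>i. i \<in> I \<Longrightarrow> subgroup (H i) G) \<Longrightarrow> subgroup (\<Inter>i\<in>I. H i) G"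
  by (rule subgroups_Inter) auto

text \<open>An \<open>n\<close>-chain for every \<open>n\<close> would give the trees refuted by
  \<open>simple_no_finite_trees\<close>, for the formula \<open>coset_fm\<close>.\<close>

theorem intersection_chain_bound:
  fixes L :: "('f, 'r) language" and M :: "('f, 'r, 'm) struct"
    and G :: "'m list monoid" (structure)
  assumes large: "(UNIV :: (('f, 'r) fm \<times> 'm list) set set) \<prec> (UNIV :: 'u set)"
    and simple: "simple_theory L T TYPE('u)"
    and model: "models L M T"
    and G: "definable_group L M d G"
    and F: "uniformly_definable_subgroups L M d G F"
  shows "\<exists>n. \<forall>H. (\<forall>i \<le> n. H i \<in> F) \<longrightarrow>
    (\<exists>i<n. index_le G (\<Inter>(H ` {..i})) (\<Inter>(H ` {..i}) \<inter> H (Suc i)) n)"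
proof (rule ccontr)
  assume "\<not> ?thesis"
  then have "\<forall>n. \<exists>H. (\<forall>i \<le> n. H i \<in> F) \<and>
      (\<forall>i<n. \<not> index_le G (\<Inter>(H ` {..i})) (\<Inter>(H ` {..i}) \<inter> H (Suc i)) n)"
    by auto
  then obtain H where H_F: "\<And>n i. i \<le> n \<Longrightarrow> H n i \<in> F"
    and index: "\<And>n i. i < n \<Longrightarrow>
      \<not> index_le G (\<Inter>(H n ` {..i})) (\<Inter>(H n ` {..i}) \<inter> H n (Suc i)) n"
    by metis
  interpret group G using G by (simp add: definable_group_def)
  have carrier: "carrier G \<subseteq> tuples M d"
    using G by (auto simp: definable_group_def dest: definable_subset)
  obtain r \<mu> b where \<mu>: "\<mu> \<in> fms L (3 * d + r)" and b: "b \<in> tuples M r"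
    and mult: "mult_graph G = defset M (3 * d) \<mu> b"
    using G by (auto simp: definable_group_def definable_def)
  obtain q \<phi> where \<phi>: "\<phi> \<in> fms L (d + q)"
    and "\<forall>H \<in> F. \<exists>a \<in> tuples M q. H = {g \<in> carrier G. holds M \<phi> (g @ a)}"
    using F unfolding uniformly_definable_subgroups_def by blast
  then obtain z where z: "\<And>H. H \<in> F \<Longrightarrow> z H \<in> tuples M q"
    and H_eq: "\<And>H. H \<in> F \<Longrightarrow> H = {g \<in> carrier G. holds M \<phi> (g @ z H)}"
    by metis
  have sub: "subgroup H G" if "H \<in> F" for H
    using F that by (simp add: uniformly_definable_subgroups_def)
  let ?\<psi> = "coset_fm d q r \<mu> \<phi>"
  \<comment> \<open>For \<open>y\<close> in the group, the formula defines the right coset of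
    \<open>y\<close> modulo \<open>H\<close> among all \<open>d\<close>-tuples.\<close>
  have coset: "holds M ?\<psi> (x @ y @ z H @ b) \<longleftrightarrow> (\<exists>w \<in> H. x = w \<otimes> y)"
    if "x \<in> tuples M d" "y \<in> carrier G" "H \<in> F" for x y H
  proof -
    have y: "y \<in> tuples M d" using carrier that by auto
    have "holds M \<mu> (w @ y @ x @ b) \<longleftrightarrow> w \<in> carrier G \<and> x = w \<otimes> y" if w: "w \<in> tuples M d" for w
    proof -
      have "w @ y @ x \<in> tuples M (3 * d)"
        using w y \<open>x \<in> tuples M d\<close> by (simp add: tuples_def)
      then have "holds M \<mu> (w @ y @ x @ b) \<longleftrightarrow> w @ y @ x \<in> mult_graph G"
        by (simp add: mult defset_def)
      then show ?thesis
        using mem_mult_graph[OF carrier w y \<open>x \<in> tuples M d\<close>] \<open>y \<in> carrier G\<close> by simp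
    qed
    then have "holds M ?\<psi> (x @ y @ z H @ b) \<longleftrightarrow>
        (\<exists>w \<in> tuples M d. (w \<in> carrier G \<and> x = w \<otimes> y) \<and> holds M \<phi> (w @ z H))"
      using holds_coset_fm[OF \<mu> \<phi> that(1) y z[OF that(3)] b] by (simp cong: bex_cong)
    also have "\<dots> \<longleftrightarrow> (\<exists>w \<in> {g \<in> carrier G. holds M \<phi> (g @ z H)}. x = w \<otimes> y)"
      using carrier by auto
    finally show ?thesis using H_eq[OF that(3)] by simp
  qed
  have "\<exists>a. (\<forall>s. a s \<in> tuples M (d + q + r)) \<and>
      (\<forall>s i j. length s < n \<and> set (s @ [i, j]) \<subseteq> {..<n} \<and> i \<noteq> j \<longrightarrow>
         \<not> (\<exists>x \<in> tuples M d. holds M ?\<psi> (x @ a (s @ [i])) \<and> holds M ?\<psi> (x @ a (s @ [j])))) \<and>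
      (\<forall>s. length s \<le> n \<and> set s \<subseteq> {..<n} \<longrightarrow>
         (\<exists>x \<in> tuples M d. \<forall>m \<le> length s. holds M ?\<psi> (x @ a (take m s))))" for n
  proof -
    define K where "K i = \<Inter>(H n ` {..i})" for i
    have K: "subgroup (K i) G" if "i \<le> n" for i
      unfolding K_def using that by (intro subgroup_INT) (auto intro!: sub H_F)
    have "\<forall>i. \<exists>h. i < n \<longrightarrow> (\<forall>j<n. h j \<in> K i) \<and>
        (\<forall>j<n. \<forall>k<n. j \<noteq> k \<longrightarrow> h j \<otimes> inv (h k) \<notin> H n (Suc i))"
    proof
      fix i
      show "\<exists>h. i < n \<longrightarrow> (\<forall>j<n. h j \<in> K i) \<and>
          (\<forall>j<n. \<forall>k<n. j \<noteq> k \<longrightarrow> h j \<otimes> inv (h k) \<notin> H n (Suc i))"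
      proof (cases "i < n")
        case True
        obtain h :: "nat \<Rightarrow> 'm list" where "\<And>j. j < n \<Longrightarrow> h j \<in> K i"
          "\<And>j k. j < n \<Longrightarrow> k < n \<Longrightarrow> j \<noteq> k \<Longrightarrow> h j \<otimes> inv (h k) \<notin> H n (Suc i)"
          using many_cosets[OF is_group K[of i] sub[OF H_F[of "Suc i" n]], of n] index[of i n] True
          by (auto simp: K_def)
        then show ?thesis by blast
      qed simp
    qed
    \<comment> \<open>The representatives depend on the level only; multiplied by the group element
      of a node on that level they give the elements of its children.\<close>
    then obtain h where h: "\<And>i j. i < n \<Longrightarrow> j < n \<Longrightarrow> h i j \<in> K i"
      and h_ne: "\<And>i j k. i < n \<Longrightarrow> j < n \<Longrightarrow> k < n \<Longrightarrow> j \<noteq> k \<Longrightarrow> h i j \<otimes> inv (h i k) \<notin> H n (Suc i)"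
      by metis
    have h_carrier: "h i j \<in> carrier G" if "i < n" "j < n" for i j
      using h[OF that] K[of i] that by (auto intro: subgroup.mem_carrier)
    have walk_carrier: "walk G h \<sigma> m \<in> carrier G" if "m \<le> n" "\<And>i. i < m \<Longrightarrow> \<sigma> i < n" for \<sigma> m
      using that by (induction m) (auto intro!: h_carrier m_closed)
    \<comment> \<open>All factors after step \<open>m\<close> lie in \<open>H n m\<close> and are
      multiplied on the left, so the walk stays in the right coset of \<open>H n m\<close> reached
      at step \<open>m\<close>.\<close>
    have walk_coset: "\<exists>w \<in> H n m. walk G h \<sigma> (m + l) = w \<otimes> walk G h \<sigma> m"
      if "m + l \<le> n" "\<And>i. i < m + l \<Longrightarrow> \<sigma> i < n" for \<sigma> m l
      using that
    proof (induction l)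
      case 0
      then show ?case
        using walk_carrier[of m \<sigma>] subgroup.one_closed[OF sub[OF H_F[of m n]]]
        by (intro bexI[of _ \<one>]) auto
    next
      case (Suc l)
      then obtain w where w: "w \<in> H n m" "walk G h \<sigma> (m + l) = w \<otimes> walk G h \<sigma> m" by auto
      let ?h = "h (m + l) (\<sigma> (m + l))"
      have H: "subgroup (H n m) G" using Suc.prems by (intro sub H_F) simp
      have "?h \<in> K (m + l)" using Suc.prems by (intro h) auto
      then have "?h \<in> H n m" by (auto simp: K_def)
      moreover have "walk G h \<sigma> m \<in> carrier G" using Suc.prems by (intro walk_carrier) auto
      ultimately show ?case
        using w H by (intro bexI[of _ "?h \<otimes> w"])
          (auto simp: m_assoc subgroup.m_closed subgroup.mem_carrier)
    qed
    \<comment> \<open>Nodes outside the finite tree get the identity and level 0, so that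
      \<open>a\<close> takes admissible values everywhere.\<close>
    let ?good = "\<lambda>s. length s \<le> n \<and> set s \<subseteq> {..<n}"
    define g where "g s = (if ?good s then walk G h (nth s) (length s) else \<one>)" for s :: "nat list"
    define lev where "lev s = (if ?good s then length s else 0)" for s :: "nat list"
    \<comment> \<open>The node \<open>s\<close> stands for the coset of \<open>g s\<close> modulo
      \<open>H n (lev s)\<close>, the root for \<open>H n 0\<close> itself.\<close>
    define a where "a s = g s @ z (H n (lev s)) @ b" for s :: "nat list"
    have g: "g s \<in> carrier G" for s
      by (auto simp: g_def subset_iff intro!: walk_carrier)
    have lev: "H n (lev s) \<in> F" for s by (auto simp: lev_def intro: H_F)
    show ?thesis
    proof (intro exI[of _ a] conjI allI impI)
      show "a s \<in> tuples M (d + q + r)" for s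
        using g[of s] carrier z[OF lev[of s]] b by (auto simp: a_def tuples_def)
    next
      fix s :: "nat list" and i j
      assume s: "length s < n \<and> set (s @ [i, j]) \<subseteq> {..<n} \<and> i \<noteq> j"
      show "\<not> (\<exists>x \<in> tuples M d. holds M ?\<psi> (x @ a (s @ [i])) \<and> holds M ?\<psi> (x @ a (s @ [j])))"
      proof
        assume "\<exists>x \<in> tuples M d. holds M ?\<psi> (x @ a (s @ [i])) \<and> holds M ?\<psi> (x @ a (s @ [j]))"
        then obtain x where x: "x \<in> tuples M d" "holds M ?\<psi> (x @ a (s @ [i]))" "holds M ?\<psi> (x @ a (s @ [j]))"
          by blast
        let ?g = "walk G h (nth s) (length s)" and ?l = "length s"
        have g_eq: "g (s @ [k]) = h ?l k \<otimes> ?g" "lev (s @ [k]) = Suc ?l" if "k < n" for k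
        proof -
          have "walk G h (nth (s @ [k])) ?l = ?g"
            by (rule walk_cong) (simp add: nth_append)
          then show "g (s @ [k]) = h ?l k \<otimes> ?g" "lev (s @ [k]) = Suc ?l"
            using s that by (auto simp: g_def lev_def)
        qed
        have H: "subgroup (H n (Suc ?l)) G" "H n (Suc ?l) \<in> F" using s by (auto intro!: sub H_F)
        have c: "?g \<in> carrier G" "h ?l i \<in> carrier G" "h ?l j \<in> carrier G"
          using s by (auto simp: subset_iff intro!: walk_carrier h_carrier)
        have mem: "\<exists>w \<in> H n (Suc ?l). x = w \<otimes> (h ?l k \<otimes> ?g)"
          if "holds M ?\<psi> (x @ a (s @ [k]))" "k < n" for k
        proof -
          have "h ?l k \<otimes> ?g \<in> carrier G" using g[of "s @ [k]"] g_eq[OF that(2)] by simp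
          then show ?thesis
            using that coset[OF x(1) _ H(2)] by (simp add: a_def g_eq)
        qed
        have ij: "i < n" "j < n" using s by auto
        \<comment> \<open>If \<open>x\<close> lies in both sibling cosets, cancelling the common
          factor \<open>?g\<close> puts the quotient of two distinct representatives into
          \<open>H n (Suc ?l)\<close>, against their choice.\<close>
        obtain w w' where w: "w \<in> H n (Suc ?l)" "w' \<in> H n (Suc ?l)"
          "x = w \<otimes> (h ?l i \<otimes> ?g)" "x = w' \<otimes> (h ?l j \<otimes> ?g)"
          using mem[OF x(2) ij(1)] mem[OF x(3) ij(2)] by auto
        have wc: "w \<in> carrier G" "w' \<in> carrier G" using w H by (auto intro: subgroup.mem_carrier)
        have "(w \<otimes> h ?l i) \<otimes> ?g = (w' \<otimes> h ?l j) \<otimes> ?g"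
          using w(3,4) wc c by (simp add: m_assoc)
        then have eq: "w \<otimes> h ?l i = w' \<otimes> h ?l j" using wc c by simp
        have "h ?l i \<otimes> inv (h ?l j) = inv w \<otimes> (w \<otimes> h ?l i) \<otimes> inv (h ?l j)"
          using wc c by (simp add: m_assoc[symmetric])
        also have "\<dots> = inv w \<otimes> w'"
          unfolding eq using wc c by (simp add: m_assoc)
        also have "\<dots> \<in> H n (Suc ?l)"
          using w H by (simp add: subgroup.m_closed subgroup.m_inv_closed)
        finally show False using h_ne s by simp
      qed
    next
      fix s :: "nat list" assume s: "?good s"
      show "\<exists>x \<in> tuples M d. \<forall>m \<le> length s. holds M ?\<psi> (x @ a (take m s))"
      \<comment> \<open>The element at the end of the branch lies in all cosets along it, by
        \<open>walk_coset\<close>.\<close>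
      proof (intro bexI[of _ "g s"] allI impI)
        show "g s \<in> tuples M d" using g carrier by auto
        fix m assume m: "m \<le> length s"
        have good: "?good (take m s)" using s m set_take_subset[of m s] by auto
        have "walk G h (nth (take m s)) m = walk G h (nth s) m"
          by (rule walk_cong) simp
        then have gm: "g (take m s) = walk G h (nth s) m" "lev (take m s) = m"
          using good m by (auto simp: g_def lev_def)
        have "s ! i < n" if "i < length s" for i using s that nth_mem by fastforce
        then have "\<exists>w \<in> H n m. g s = w \<otimes> g (take m s)"
          using walk_coset[of m "length s - m" "nth s"] s m by (simp add: gm) (simp add: g_def)
        then show "holds M ?\<psi> (g s @ a (take m s))"
          using coset[of "g s" "g (take m s)" "H n m"] g carrier lev[of "take m s"]
          by (auto simp: a_def gm(2))
      qed
    qed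
  qed
  then show False
    by (rule simple_no_finite_trees[OF large simple model coset_fm_in[OF \<mu> \<phi>]])
qed

subsection \<open>Transfer along elementary extensions\<close>

locale elem_ext =
  fixes L :: "('f, 'r) language" and M :: "('f, 'r, 'm) struct" and N :: "('f, 'r, 'u) struct"
    and e :: "'m \<Rightarrow> 'u"
  assumes M_struct: "is_structure L M"
    and elem: "elementary_ext L M N e"
begin

lemma N_struct: "is_structure L N"
  using elem by (simp add: elementary_ext_def)

lemma e_univ: "x \<in> univ M \<Longrightarrow> e x \<in> univ N"
  using elem by (auto simp: elementary_ext_def)

lemma map_e_tuples: "xs \<in> tuples M n \<Longrightarrow> map e xs \<in> tuples N n"
  using e_univ by (auto simp: tuples_def)

text \<open>Otherwise the negation of \<open>\<phi>\<close>, existentially closed over the variables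
  past the parameters, would hold of \<open>map e a\<close> in \<open>N\<close> and so of
  \<open>a\<close> in \<open>M\<close>.\<close>

lemma universal_closure:
  assumes \<phi>: "fm_in L \<phi>" and a: "set a \<subseteq> univ M"
    and M: "\<And>\<sigma>. range \<sigma> \<subseteq> univ M \<Longrightarrow> (\<And>v. v < length a \<Longrightarrow> \<sigma> v = a ! v) \<Longrightarrow> sat M \<sigma> \<phi>"
    and \<tau>: "range \<tau> \<subseteq> univ N" "\<And>v. v < length a \<Longrightarrow> \<tau> v = e (a ! v)"
  shows "sat N \<tau> \<phi>"
proof (rule ccontr)
  assume not: "\<not> sat N \<tau> \<phi>"
  let ?k = "length a"
  obtain m where m: "\<And>v. v \<in> free_vars \<phi> \<Longrightarrow> v < ?k + m"
    using finite_nat_set_iff_bounded[of "free_vars \<phi>"] finite_free_vars[of \<phi>] by (metis trans_less_add2)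
  define \<psi> where "\<psi> = exs m ?k (Neg \<phi>)"
  have \<psi>: "\<psi> \<in> fms L ?k"
    using \<phi> m by (fastforce simp: \<psi>_def fms_def)
  have "holds N \<psi> (map e a)"
    unfolding holds_def \<psi>_def sat_exs
  proof (intro bexI[of _ "map \<tau> [?k..<?k + m]"])
    have "sat N (\<lambda>v. if ?k \<le> v \<and> v < ?k + m then map \<tau> [?k..<?k + m] ! (v - ?k) else map e a ! v) \<phi> =
        sat N \<tau> \<phi>"
      by (rule sat_cong) (use m \<tau>(2) in fastforce)
    then show "sat N (\<lambda>v. if ?k \<le> v \<and> v < ?k + m then map \<tau> [?k..<?k + m] ! (v - ?k)
        else map e a ! v) (Neg \<phi>)"
      using not by simp
    show "map \<tau> [?k..<?k + m] \<in> tuples N m" using \<tau>(1) by (auto simp: tuples_def)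
  qed
  moreover have "a \<in> tuples M ?k" using a by (simp add: tuples_def)
  ultimately have "holds M \<psi> a"
    using elem \<psi> by (auto simp: elementary_ext_def)
  then obtain xs where xs: "xs \<in> tuples M m"
      "\<not> sat M (\<lambda>v. if ?k \<le> v \<and> v < ?k + m then xs ! (v - ?k) else a ! v) \<phi>"
    by (auto simp: holds_def \<psi>_def sat_exs)
  obtain u where u: "u \<in> univ M" using M_struct by (auto simp: is_structure_def)
  \<comment> \<open>Past the quantified block the value is arbitrary; \<open>u\<close> keeps
    \<open>\<sigma>\<close> inside \<open>M\<close>.\<close>
  define \<sigma> where "\<sigma> v = (if v < ?k then a ! v else if v < ?k + m then xs ! (v - ?k) else u)" for v
  have "range \<sigma> \<subseteq> univ M"
    using a u xs(1) by (auto simp: \<sigma>_def intro!: tuples_nth[OF xs(1)] dest: nth_mem)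
  then have "sat M \<sigma> \<phi>" by (rule M) (simp add: \<sigma>_def)
  moreover have "sat M \<sigma> \<phi> = sat M (\<lambda>v. if ?k \<le> v \<and> v < ?k + m then xs ! (v - ?k) else a ! v) \<phi>"
    by (rule sat_cong) (use m in \<open>auto simp: \<sigma>_def\<close>)
  ultimately show False using xs(2) by simp
qed

end

text \<open>Predicates are taken on environments assigning a \<open>d\<close>-tuple to every block index; the block
  \<open>k\<close> occupies \<open>d\<close> consecutive variables, after those holding the parameters \<open>a\<close>.\<close>

definition env :: "('f, 'r, 'm) struct \<Rightarrow> nat \<Rightarrow> (nat \<Rightarrow> 'm list) \<Rightarrow> bool" where
  "env M d s \<longleftrightarrow> (\<forall>k. s k \<in> tuples M d)"

definition asg :: "nat \<Rightarrow> 'm list \<Rightarrow> (nat \<Rightarrow> 'm list) \<Rightarrow> nat \<Rightarrow> 'm" where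
  "asg d a s v = (if v < length a then a ! v
     else s ((v - length a) div d) ! ((v - length a) mod d))"

lemma asg_param [simp]: "v < length a \<Longrightarrow> asg d a s v = a ! v"
  by (simp add: asg_def)

lemma asg_block [simp]: "i < d \<Longrightarrow> asg d a s (length a + (d * k + i)) = s k ! i"
  by (simp add: asg_def)

text \<open>Division with remainder finds the block and the position of a variable past the
  parameters; this takes \<open>0 < d\<close>.\<close>

lemma asg_cases:
  assumes "v < length a \<or> 0 < d"
  obtains "v < length a" | k i where "i < d" "v = length a + (d * k + i)"
proof (cases "v < length a")
  case False
  then show ?thesis
    using that(2)[of "(v - length a) mod d" "(v - length a) div d"] assms by simp
qed (rule that(1))

text \<open>Changing one block changes \<open>d\<close> consecutive variables, which is the form of
  update in \<open>sat_exs\<close>.\<close>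

lemma asg_upd:
  assumes "v < length a \<or> 0 < d"
  shows "asg d a (s(k := x)) v =
    (if length a + d * k \<le> v \<and> v < length a + d * k + d then x ! (v - (length a + d * k)) else asg d a s v)"
  using assms
proof (cases rule: asg_cases)
  case (2 l i)
  have "l = k \<longleftrightarrow> d * k \<le> d * l + i \<and> d * l + i < d * k + d"
  proof
    assume r: "d * k \<le> d * l + i \<and> d * l + i < d * k + d"
    have "k < Suc l"
    proof (rule mult_less_cancel1[THEN iffD1, THEN conjunct2])
      show "d * k < d * Suc l" using r 2 by simp
    qed
    moreover have "l < Suc k"
    proof (rule mult_less_cancel1[THEN iffD1, THEN conjunct2])
      show "d * l < d * Suc k" using r 2 by simp
    qed
    ultimately show "l = k" by simp
  qed (use 2 in simp)
  then show ?thesis using 2 by auto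
qed simp

lemma asg_range:
  assumes "set a \<subseteq> univ M" "env M d s" "v < length a \<or> 0 < d"
  shows "asg d a s v \<in> univ M"
  using assms(3)
proof (cases rule: asg_cases)
  case 1
  then show ?thesis using assms(1) by (auto dest: nth_mem)
next
  case (2 k i)
  then show ?thesis using assms(2) by (auto simp: env_def intro: tuples_nth)
qed

text \<open>For joining two formulas over the parameters \<open>a @ b\<close>: the first keeps its
  parameters, and its block variables move up past \<open>b\<close>.\<close>

lemma asg_append_left:
  assumes "v < length a \<or> 0 < d"
  shows "asg d (a @ b) s (if v < length a then v else v + length b) = asg d a s v"
  using assms
proof (cases rule: asg_cases)
  case (2 k i)
  then show ?thesis using asg_block[of i d "a @ b" s k] asg_block[of i d a s k] by (simp add: algebra_simps)
qed (simp add: nth_append)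

lemma asg_append_right:
  assumes "v < length a \<or> 0 < d"
  shows "asg d (b @ a) s (v + length b) = asg d a s v"
  using assms
proof (cases rule: asg_cases)
  case (2 k i)
  then show ?thesis using asg_block[of i d "b @ a" s k] asg_block[of i d a s k] by (simp add: algebra_simps)
qed (simp add: nth_append)

lemma nth_concat:
  assumes "\<And>x. x \<in> set xs \<Longrightarrow> length x = d" "v < length xs * d"
  shows "concat xs ! v = xs ! (v div d) ! (v mod d)"
  using assms
proof (induction xs arbitrary: v)
  case (Cons x xs)
  show ?case
  proof (cases "v < d")
    case False
    have "0 < d" using Cons.prems(2) by (cases d) auto
    then have "v div d = Suc ((v - d) div d)" "v mod d = (v - d) mod d"
      using False by (simp_all add: le_div_geq le_mod_geq not_less)
    then show ?thesis
      using False Cons by (simp add: nth_append)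
  qed (use Cons.prems in \<open>simp add: nth_append\<close>)
qed simp

lemma length_concat_const: "(\<And>x. x \<in> set xs \<Longrightarrow> length x = d) \<Longrightarrow> length (concat xs) = length xs * d"
  by (induction xs) auto

section \<open>Predicates on tuples given by one formula in both structures\<close>

context elem_ext
begin

text \<open>For \<open>d = 0\<close> the blocks contain no variables, so that \<open>asg\<close> is junk beyond the parameters.\<close>

definition transfer :: "nat \<Rightarrow> ((nat \<Rightarrow> 'm list) \<Rightarrow> bool) \<Rightarrow> ((nat \<Rightarrow> 'u list) \<Rightarrow> bool) \<Rightarrow> bool" where
  "transfer d P Q \<longleftrightarrow> (\<exists>\<phi> a. fm_in L \<phi> \<and> set a \<subseteq> univ M \<and> (\<forall>v \<in> free_vars \<phi>. v < length a \<or> 0 < d) \<and>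
     (\<forall>s. env M d s \<longrightarrow> P s = sat M (asg d a s) \<phi>) \<and>
     (\<forall>s. env N d s \<longrightarrow> Q s = sat N (asg d (map e a) s) \<phi>))"

lemma transferI:
  assumes "fm_in L \<phi>" "set a \<subseteq> univ M" "\<And>v. v \<in> free_vars \<phi> \<Longrightarrow> v < length a \<or> 0 < d"
    "\<And>s. env M d s \<Longrightarrow> P s = sat M (asg d a s) \<phi>"
    "\<And>s. env N d s \<Longrightarrow> Q s = sat N (asg d (map e a) s) \<phi>"
  shows "transfer d P Q"
  using assms unfolding transfer_def by blast

lemma transferE:
  assumes "transfer d P Q"
  obtains \<phi> a where "fm_in L \<phi>" "set a \<subseteq> univ M" "\<And>v. v \<in> free_vars \<phi> \<Longrightarrow> v < length a \<or> 0 < d"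
    "\<And>s. env M d s \<Longrightarrow> P s = sat M (asg d a s) \<phi>"
    "\<And>s. env N d s \<Longrightarrow> Q s = sat N (asg d (map e a) s) \<phi>"
  using assms unfolding transfer_def by blast

text \<open>The purpose of \<open>transfer\<close>: a law of all \<open>d\<close>-tuples in
  \<open>M\<close> passes to \<open>N\<close> by \<open>universal_closure\<close>.\<close>

lemma transfer_all:
  assumes "transfer d P Q" "\<And>s. env M d s \<Longrightarrow> P s" "env N d t"
  shows "Q t"
proof -
  obtain \<phi> a where \<phi>: "fm_in L \<phi>" and a: "set a \<subseteq> univ M"
    and fv: "\<And>v. v \<in> free_vars \<phi> \<Longrightarrow> v < length a \<or> 0 < d"
    and P: "\<And>s. env M d s \<Longrightarrow> P s = sat M (asg d a s) \<phi>"
    and Q: "\<And>s. env N d s \<Longrightarrow> Q s = sat N (asg d (map e a) s) \<phi>"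
    using transferE[OF assms(1)] by metis
  obtain u where u: "u \<in> univ M" using M_struct by (auto simp: is_structure_def)
  \<comment> \<open>If \<open>d = 0\<close>, the values of \<open>asg\<close> past the parameters
    need not lie in the universe; \<open>e u\<close> replaces them.\<close>
  define \<tau> where "\<tau> v = (if v < length a \<or> 0 < d then asg d (map e a) t v else e u)" for v
  have ea: "set (map e a) \<subseteq> univ N" using a e_univ by auto
  have "sat N \<tau> \<phi>"
  proof (rule universal_closure[OF \<phi> a])
    fix \<sigma> assume \<sigma>: "range \<sigma> \<subseteq> univ M" "\<And>v. v < length a \<Longrightarrow> \<sigma> v = a ! v"
    \<comment> \<open>Cuts the variables of \<open>\<sigma>\<close> past the parameters into blocks
      of length \<open>d\<close>.\<close>
    define s where "s k = map (\<lambda>i. \<sigma> (length a + (d * k + i))) [0..<d]" for k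
    have "env M d s" using \<sigma>(1) by (auto simp: env_def s_def tuples_def)
    then have "sat M (asg d a s) \<phi>" using P assms(2) by blast
    moreover have "sat M (asg d a s) \<phi> = sat M \<sigma> \<phi>"
    proof (rule sat_cong)
      fix v assume "v \<in> free_vars \<phi>"
      then have "v < length a \<or> 0 < d" by (rule fv)
      then show "asg d a s v = \<sigma> v"
        by (cases rule: asg_cases) (simp_all add: \<sigma>(2) s_def)
    qed
    ultimately show "sat M \<sigma> \<phi>" by simp
  next
    show "range \<tau> \<subseteq> univ N"
      using asg_range[OF ea assms(3)] e_univ[OF u] by (auto simp: \<tau>_def)
  qed (simp add: \<tau>_def)
  moreover have "sat N \<tau> \<phi> = sat N (asg d (map e a) t) \<phi>"
    by (rule sat_cong) (use fv in \<open>auto simp: \<tau>_def\<close>)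
  ultimately show ?thesis using Q[OF assms(3)] by simp
qed

text \<open>The closure rules from here on let a first-order law be transferred by introduction
  rules, without writing out its formula.\<close>

lemma transfer_not: "transfer d P Q \<Longrightarrow> transfer d (\<lambda>s. \<not> P s) (\<lambda>s. \<not> Q s)"
  by (erule transferE, rule_tac \<phi> = "Neg \<phi>" in transferI) auto

lemma transfer_conj:
  assumes "transfer d P Q" "transfer d P' Q'"
  shows "transfer d (\<lambda>s. P s \<and> P' s) (\<lambda>s. Q s \<and> Q' s)"
proof -
  obtain \<phi> a where \<phi>: "fm_in L \<phi>" and a: "set a \<subseteq> univ M"
    and fv: "\<And>v. v \<in> free_vars \<phi> \<Longrightarrow> v < length a \<or> 0 < d"
    and P: "\<And>s. env M d s \<Longrightarrow> P s = sat M (asg d a s) \<phi>"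
    and Q: "\<And>s. env N d s \<Longrightarrow> Q s = sat N (asg d (map e a) s) \<phi>"
    using transferE[OF assms(1)] by metis
  obtain \<phi>' a' where \<phi>': "fm_in L \<phi>'" and a': "set a' \<subseteq> univ M"
    and fv': "\<And>v. v \<in> free_vars \<phi>' \<Longrightarrow> v < length a' \<or> 0 < d"
    and P': "\<And>s. env M d s \<Longrightarrow> P' s = sat M (asg d a' s) \<phi>'"
    and Q': "\<And>s. env N d s \<Longrightarrow> Q' s = sat N (asg d (map e a') s) \<phi>'"
    using transferE[OF assms(2)] by metis
  let ?f = "\<lambda>v. if v < length a then v else v + length a'"
  let ?\<psi> = "Conj (ren ?f \<phi>) (ren (\<lambda>v. v + length a) \<phi>')"
  show ?thesis
  proof (rule transferI[of ?\<psi> "a @ a'"])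
    show "v < length (a @ a') \<or> 0 < d" if "v \<in> free_vars ?\<psi>" for v
      using that free_vars_ren[of ?f \<phi>] free_vars_ren[of "\<lambda>v. v + length a" \<phi>'] fv fv'
      by (fastforce split: if_splits)
    have "sat M (\<lambda>v. asg d (a @ a') s (?f v)) \<phi> = sat M (asg d a s) \<phi>" for s
      by (rule sat_cong) (use asg_append_left[of _ a d a' s] fv in blast)
    moreover have "sat M (\<lambda>v. asg d (a @ a') s (v + length a)) \<phi>' = sat M (asg d a' s) \<phi>'" for s
      by (rule sat_cong) (use asg_append_right[of _ a' d a s] fv' in blast)
    ultimately show "(P s \<and> P' s) = sat M (asg d (a @ a') s) ?\<psi>" if "env M d s" for s
      using that by (simp add: P P')
    have "sat N (\<lambda>v. asg d (map e (a @ a')) s (?f v)) \<phi> = sat N (asg d (map e a) s) \<phi>" for s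
    proof (rule sat_cong)
      fix v assume "v \<in> free_vars \<phi>"
      then show "asg d (map e (a @ a')) s (?f v) = asg d (map e a) s v"
        using asg_append_left[of v "map e a" d "map e a'" s] fv[of v]
        by (cases "v < length a") (auto simp: nth_append)
    qed
    moreover have "sat N (\<lambda>v. asg d (map e (a @ a')) s (v + length a)) \<phi>' = sat N (asg d (map e a') s) \<phi>'" for s
    proof (rule sat_cong)
      fix v assume "v \<in> free_vars \<phi>'"
      then show "asg d (map e (a @ a')) s (v + length a) = asg d (map e a') s v"
        using asg_append_right[of v "map e a'" d "map e a" s] fv'[of v] by simp
    qed
    ultimately show "(Q s \<and> Q' s) = sat N (asg d (map e (a @ a')) s) ?\<psi>" if "env N d s" for s
      using that by (simp add: Q Q')
  qed (use \<phi> \<phi>' a a' in auto)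
qed

lemma transfer_imp:
  "transfer d P Q \<Longrightarrow> transfer d P' Q' \<Longrightarrow> transfer d (\<lambda>s. P s \<longrightarrow> P' s) (\<lambda>s. Q s \<longrightarrow> Q' s)"
  using transfer_not[OF transfer_conj[OF _ transfer_not, of d P Q P' Q']] by simp

lemma transfer_iff:
  "transfer d P Q \<Longrightarrow> transfer d P' Q' \<Longrightarrow> transfer d (\<lambda>s. P s \<longleftrightarrow> P' s) (\<lambda>s. Q s \<longleftrightarrow> Q' s)"
  using transfer_conj[OF transfer_imp[of d P Q P' Q'] transfer_imp[of d P' Q' P Q]]
  by (simp add: iff_conv_conj_imp)

text \<open>The formula has to be a sentence, since for \<open>d = 0\<close> and no parameters no
  variable may be free; it holds because universes are nonempty.\<close>

lemma transfer_True: "transfer d (\<lambda>_. True) (\<lambda>_. True)"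
  by (rule transferI[of "Ex 0 (Eql (Var 0) (Var 0))" "[]"])
    (use M_struct N_struct in \<open>auto simp: is_structure_def\<close>)

lemma transfer_ball:
  assumes "finite I" "\<And>i. i \<in> I \<Longrightarrow> transfer d (P i) (Q i)"
  shows "transfer d (\<lambda>s. \<forall>i\<in>I. P i s) (\<lambda>s. \<forall>i\<in>I. Q i s)"
  using assms by (induction I rule: finite_induct) (auto intro: transfer_conj transfer_True)

lemma transfer_bex:
  assumes "finite I" "\<And>i. i \<in> I \<Longrightarrow> transfer d (P i) (Q i)"
  shows "transfer d (\<lambda>s. \<exists>i\<in>I. P i s) (\<lambda>s. \<exists>i\<in>I. Q i s)"
  using transfer_not[OF transfer_ball[OF assms(1) transfer_not[OF assms(2)]]] by simp

text \<open>Block \<open>k\<close> starts at variable \<open>length a + d * k\<close>, so a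
  quantifier over \<open>d\<close>-tuples is \<open>exs\<close> from there.\<close>

lemma transfer_ex:
  assumes "transfer d P Q"
  shows "transfer d (\<lambda>s. \<exists>x \<in> tuples M d. P (s(k := x))) (\<lambda>s. \<exists>x \<in> tuples N d. Q (s(k := x)))"
proof -
  obtain \<phi> a where \<phi>: "fm_in L \<phi>" and a: "set a \<subseteq> univ M"
    and fv: "\<And>v. v \<in> free_vars \<phi> \<Longrightarrow> v < length a \<or> 0 < d"
    and P: "\<And>s. env M d s \<Longrightarrow> P s = sat M (asg d a s) \<phi>"
    and Q: "\<And>s. env N d s \<Longrightarrow> Q s = sat N (asg d (map e a) s) \<phi>"
    using transferE[OF assms] by metis
  have upd: "sat S (asg d c (s(k := x))) \<phi> = sat S (\<lambda>v. if length a + d * k \<le> v \<and>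
      v < length a + d * k + d then x ! (v - (length a + d * k)) else asg d c s v) \<phi>"
    if "length c = length a" for S :: "('f, 'r, 'x) struct" and c s x
    by (rule sat_cong) (use fv asg_upd[of _ c d s k x] that in simp)
  have "env M d (s(k := x))" if "env M d s" "x \<in> tuples M d" for s x
    using that by (simp add: env_def)
  moreover have "env N d (s(k := x))" if "env N d s" "x \<in> tuples N d" for s x
    using that by (simp add: env_def)
  ultimately show ?thesis
    by (intro transferI[of "exs d (length a + d * k) \<phi>" a])
      (auto simp: \<phi> a[THEN subsetD] sat_exs P Q upd dest: fv)
qed

lemma transfer_holds:
  assumes \<phi>: "\<phi> \<in> fms L (length ks * d + length a)" and a: "set a \<subseteq> univ M"
  shows "transfer d (\<lambda>s. holds M \<phi> (concat (map s ks) @ a))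
    (\<lambda>s. holds N \<phi> (concat (map s ks) @ map e a))"
proof -
  \<comment> \<open>Position \<open>v\<close> of the concatenation is position
    \<open>v mod d\<close> of the block \<open>ks ! (v div d)\<close>; the positions after all
    blocks are the parameters.\<close>
  let ?f = "\<lambda>v. if v < length ks * d then length a + (d * (ks ! (v div d)) + v mod d)
    else v - length ks * d"
  have asg: "asg d c s (?f v) = (concat (map s ks) @ c) ! v"
    if "v \<in> free_vars \<phi>" "\<And>k. length (s k) = d" "length c = length a" for v c and s :: "nat \<Rightarrow> 'x list"
  proof -
    have v: "v < length ks * d + length a" using \<phi> that(1) by (auto simp: fms_def)
    have len: "length (concat (map s ks)) = length ks * d"
      using that(2) by (subst length_concat_const[where d = d]) auto
    show ?thesis
    proof (cases "v < length ks * d")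
      case True
      then have "0 < d" by (auto intro: Nat.gr0I)
      then have "v div d < length ks" using True by (simp add: div_less_iff_less_mult)
      moreover have "concat (map s ks) ! v = map s ks ! (v div d) ! (v mod d)"
        using True that(2) by (intro nth_concat) auto
      ultimately show ?thesis
        using True \<open>0 < d\<close> len asg_block[of "v mod d" d c s "ks ! (v div d)"]
        by (simp add: nth_append that(3))
    next
      case False
      then show ?thesis using v len that(3) by (simp add: nth_append)
    qed
  qed
  have "sat M (\<lambda>v. asg d a s (?f v)) \<phi> = holds M \<phi> (concat (map s ks) @ a)" if "env M d s" for s
    unfolding holds_def by (rule sat_cong, rule asg) (use that in \<open>auto simp: env_def tuples_def\<close>)
  moreover have "sat N (\<lambda>v. asg d (map e a) s (?f v)) \<phi> = holds N \<phi> (concat (map s ks) @ map e a)"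
    if "env N d s" for s
    unfolding holds_def by (rule sat_cong, rule asg) (use that in \<open>auto simp: env_def tuples_def\<close>)
  moreover have "v < length a \<or> 0 < d" if "v \<in> free_vars (ren ?f \<phi>)" for v
    using that free_vars_ren[of ?f \<phi>] \<phi> by (fastforce simp: fms_def subset_iff split: if_splits)
  ultimately show ?thesis
    using \<phi> a by (intro transferI[of "ren ?f \<phi>" a]) (auto simp: fms_def)
qed

text \<open>That two definitions give the same set is a law of \<open>M\<close>, so they give the
  same set in \<open>N\<close>, and the union over all definitions in \<open>ext\<close> collapses
  to any one of them.\<close>

lemma ext_defset:
  assumes \<phi>: "\<phi> \<in> fms L (n + q)" and a: "a \<in> tuples M q"
  shows "Defs.ext L M N e n (defset M n \<phi> a) = defset N n \<phi> (map e a)"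
proof -
  have "x \<in> defset N n \<phi> (map e a)"
    if \<phi>': "\<phi>' \<in> fms L (n + q')" and a': "a' \<in> tuples M q'"
      and eq: "defset M n \<phi> a = defset M n \<phi>' a'" and x: "x \<in> defset N n \<phi>' (map e a')"
    for x q' \<phi>' a'
  proof -
    have "transfer n (\<lambda>s. holds M \<phi> (concat (map s [0]) @ a) \<longleftrightarrow> holds M \<phi>' (concat (map s [0]) @ a'))
       (\<lambda>s. holds N \<phi> (concat (map s [0]) @ map e a) \<longleftrightarrow> holds N \<phi>' (concat (map s [0]) @ map e a'))"
      using \<phi> \<phi>' a a' by (intro transfer_iff transfer_holds) (auto simp: tuples_def)
    moreover have "holds M \<phi> (concat (map s [0]) @ a) \<longleftrightarrow> holds M \<phi>' (concat (map s [0]) @ a')"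
      if "env M n s" for s
      using that eq by (auto simp: env_def defset_def)
    moreover have "env N n (\<lambda>_. x)" using x by (auto simp: env_def defset_def)
    ultimately have "holds N \<phi> (x @ map e a) \<longleftrightarrow> holds N \<phi>' (x @ map e a')"
      using transfer_all[of n _ _ "\<lambda>_. x"] by fastforce
    then show ?thesis using x by (simp add: defset_def)
  qed
  then show ?thesis using assms unfolding Defs.ext_def by blast
qed

lemma ext_subset_tuples: "Defs.ext L M N e n D \<subseteq> tuples N n"
  by (auto simp: Defs.ext_def defset_def)

lemma transfer_mem_concat:
  assumes "definable L M (length ks * d) D"
  shows "transfer d (\<lambda>s. concat (map s ks) \<in> D) (\<lambda>s. concat (map s ks) \<in> Defs.ext L M N e (length ks * d) D)"
proof -
  obtain q \<phi> a where D: "\<phi> \<in> fms L (length ks * d + q)" "a \<in> tuples M q" "D = defset M (length ks * d) \<phi> a"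
    using assms by (auto simp: definable_def)
  have concat: "concat (map s ks) \<in> tuples S (length ks * d)" if "env S d s" for S :: "('f, 'r, 'x) struct" and s
  proof -
    have "length (concat (map s ks)) = length ks * d"
      using that by (subst length_concat_const[where d = d]) (auto simp: env_def tuples_def)
    then show ?thesis using that by (fastforce simp: env_def tuples_def)
  qed
  have "transfer d (\<lambda>s. holds M \<phi> (concat (map s ks) @ a)) (\<lambda>s. holds N \<phi> (concat (map s ks) @ map e a))"
    using D by (intro transfer_holds) (auto simp: tuples_def)
  then show ?thesis
    using concat[of M] concat[of N] unfolding D(3) ext_defset[OF D(1,2)]
    by (auto simp: transfer_def defset_def)
qed

lemma transfer_mem:
  "definable L M d D \<Longrightarrow> transfer d (\<lambda>s. s i \<in> D) (\<lambda>s. s i \<in> Defs.ext L M N e d D)"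
  using transfer_mem_concat[of "[i]" d D] by simp

lemma transfer_mem3:
  "definable L M (3 * d) D \<Longrightarrow>
    transfer d (\<lambda>s. s i @ s j @ s k \<in> D) (\<lambda>s. s i @ s j @ s k \<in> Defs.ext L M N e (3 * d) D)"
  using transfer_mem_concat[of "[i, j, k]" d D] by (simp add: numeral_3_eq_3)

lemma transfer_cong:
  assumes "transfer d P Q" "\<And>s. env M d s \<Longrightarrow> P s = P' s" "\<And>s. env N d s \<Longrightarrow> Q s = Q' s"
  shows "transfer d P' Q'"
  using assms unfolding transfer_def by metis

text \<open>Equality of tuples is a finite conjunction over their coordinates.\<close>

lemma transfer_eq: "transfer d (\<lambda>s. s i = s j) (\<lambda>s. s i = s j)"
proof -
  have *: "transfer d (\<lambda>s. s i ! l = s j ! l) (\<lambda>s. s i ! l = s j ! l)" if "l < d" for l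
    using that
    by (intro transferI[of "Eql (Var (d * i + l)) (Var (d * j + l))" "[]"]) (auto simp: asg_def)
  show ?thesis
    by (rule transfer_cong[OF transfer_ball[OF finite_lessThan[of d] *]])
      (auto simp: env_def tuples_def intro!: nth_equalityI)
qed

lemma transfer_eq_const:
  assumes "c \<in> tuples M d"
  shows "transfer d (\<lambda>s. s i = c) (\<lambda>s. s i = map e c)"
proof -
  have *: "transfer d (\<lambda>s. s i ! l = c ! l) (\<lambda>s. s i ! l = map e c ! l)" if "l < d" for l
  proof (rule transferI[of "Eql (Var (1 + (d * i + l))) (Var 0)" "[c ! l]"])
    show "(s i ! l = c ! l) = sat M (asg d [c ! l] s) (Eql (Var (1 + (d * i + l))) (Var 0))" for s
      using that asg_block[of l d "[c ! l]" s i] by simp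
    show "(s i ! l = map e c ! l) =
        sat N (asg d (map e [c ! l]) s) (Eql (Var (1 + (d * i + l))) (Var 0))" for s
      using that assms asg_block[of l d "map e [c ! l]" s i] by (simp add: tuples_def)
  qed (use that tuples_nth[OF assms] in auto)
  have "env M d s \<Longrightarrow> (\<forall>l \<in> {..<d}. s i ! l = c ! l) = (s i = c)" for s
    using assms by (auto simp: env_def tuples_def intro!: nth_equalityI)
  moreover have "env N d s \<Longrightarrow> (\<forall>l \<in> {..<d}. s i ! l = map e c ! l) = (s i = map e c)" for s
    using assms by (auto simp: env_def tuples_def intro!: nth_equalityI)
  ultimately show ?thesis
    by (intro transfer_cong[OF transfer_ball[OF finite_lessThan[of d] *]]) auto
qed

lemma transfer_definable:
  assumes "transfer d P Q"
  shows "definable L M d {x \<in> tuples M d. P (\<lambda>_. x)}"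
    and "Defs.ext L M N e d {x \<in> tuples M d. P (\<lambda>_. x)} = {x \<in> tuples N d. Q (\<lambda>_. x)}"
proof -
  obtain \<phi> a where \<phi>: "fm_in L \<phi>" and a: "set a \<subseteq> univ M"
    and fv: "\<And>v. v \<in> free_vars \<phi> \<Longrightarrow> v < length a \<or> 0 < d"
    and P: "\<And>s. env M d s \<Longrightarrow> P s = sat M (asg d a s) \<phi>"
    and Q: "\<And>s. env N d s \<Longrightarrow> Q s = sat N (asg d (map e a) s) \<phi>"
    using transferE[OF assms] by metis
  \<comment> \<open>In a constant environment every block is \<open>x\<close>, so all blocks are
    folded onto the first \<open>d\<close> variables, with the parameters behind them.\<close>
  let ?f = "\<lambda>v. if v < length a then d + v else (v - length a) mod d"
  have "?f v < d + length a" if "v \<in> free_vars \<phi>" for v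
    using fv[OF that] by (auto intro: trans_less_add1)
  then have "?f ` free_vars \<phi> \<subseteq> {..<d + length a}"
    unfolding image_subset_iff lessThan_iff by blast
  then have in_fms: "ren ?f \<phi> \<in> fms L (d + length a)"
    using \<phi> order_trans[OF free_vars_ren[of ?f \<phi>]] by (simp add: fms_def)
  have sat: "sat S (asg d c (\<lambda>_. x)) \<phi> = holds S (ren ?f \<phi>) (x @ c)"
    if "length c = length a" "length x = d" for S :: "('f, 'r, 'x) struct" and c x
    unfolding holds_def sat_ren
  proof (rule sat_cong)
    fix v assume "v \<in> free_vars \<phi>"
    then have "v < length a \<or> 0 < d" by (rule fv)
    then show "asg d c (\<lambda>_. x) v = (x @ c) ! ?f v"
      using that by (auto simp: asg_def nth_append)
  qed
  have "{x \<in> tuples M d. P (\<lambda>_. x)} = defset M d (ren ?f \<phi>) a"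
    using P sat[of a] by (auto simp: defset_def env_def tuples_def)
  moreover have "{x \<in> tuples N d. Q (\<lambda>_. x)} = defset N d (ren ?f \<phi>) (map e a)"
    using Q sat[of "map e a"] by (auto simp: defset_def env_def tuples_def)
  moreover have "a \<in> tuples M (length a)" using a by (simp add: tuples_def)
  ultimately show "definable L M d {x \<in> tuples M d. P (\<lambda>_. x)}"
      "Defs.ext L M N e d {x \<in> tuples M d. P (\<lambda>_. x)} = {x \<in> tuples N d. Q (\<lambda>_. x)}"
    using in_fms ext_defset[OF in_fms] by (auto simp: definable_def)
qed

end

subsection \<open>The group in an elementary extension\<close>

locale elem_ext_group = elem_ext L M N e
  for L :: "('f, 'r) language" and M :: "('f, 'r, 'm) struct" and N :: "('f, 'r, 'u) struct"
    and e :: "'m \<Rightarrow> 'u" +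
  fixes d :: nat and G :: "'m list monoid"
  assumes def_group: "definable_group L M d G"
begin

abbreviation ext_set :: "'m list set \<Rightarrow> 'u list set" where
  "ext_set D \<equiv> Defs.ext L M N e d D"

abbreviation ext_graph :: "'u list set" where
  "ext_graph \<equiv> Defs.ext L M N e (3 * d) (mult_graph G)"

abbreviation ext_G :: "'u list monoid" where
  "ext_G \<equiv> ext_group L M N e d G"

sublocale G: group G
  using def_group by (simp add: definable_group_def)

lemma def_carrier: "definable L M d (carrier G)"
  and def_graph: "definable L M (3 * d) (mult_graph G)"
  using def_group by (simp_all add: definable_group_def)

lemma carrier_tuples: "carrier G \<subseteq> tuples M d"
  using def_carrier by (rule definable_subset)

lemma graph_iff:
  "env M d s \<Longrightarrow> s i @ s j @ s k \<in> mult_graph G \<longleftrightarrow>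
    s i \<in> carrier G \<and> s j \<in> carrier G \<and> s k = s i \<otimes>\<^bsub>G\<^esub> s j"
  by (rule mem_mult_graph[OF carrier_tuples]) (simp_all add: env_def)

lemma env_upd [simp]: "x \<in> tuples S d \<Longrightarrow> env S d s \<Longrightarrow> env S d (s(k := x))"
  by (simp add: env_def)

lemma env_const [simp]: "env S d (\<lambda>_. x) \<longleftrightarrow> x \<in> tuples S d"
  by (simp add: env_def)

lemmas transfer_graph = transfer_mem3[OF def_graph]
lemmas transfer_carrier = transfer_mem[OF def_carrier]

lemma ext_set_tuples: "x \<in> ext_set D \<Longrightarrow> x \<in> tuples N d"
  using ext_subset_tuples by blast

lemmas ext_carrier_tuples = ext_set_tuples[of _ "carrier G"]

lemma one_tuple: "\<one>\<^bsub>G\<^esub> \<in> tuples M d"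
  using carrier_tuples by auto

lemma ext_graph_carrier:
  assumes "x \<in> tuples N d" "y \<in> tuples N d" "z \<in> tuples N d" "x @ y @ z \<in> ext_graph"
  shows "x \<in> ext_set (carrier G)" "y \<in> ext_set (carrier G)" "z \<in> ext_set (carrier G)"
proof -
  have "transfer d (\<lambda>s. s 0 @ s 1 @ s 2 \<in> mult_graph G \<longrightarrow>
        s 0 \<in> carrier G \<and> s 1 \<in> carrier G \<and> s 2 \<in> carrier G)
      (\<lambda>s. s 0 @ s 1 @ s 2 \<in> ext_graph \<longrightarrow>
        s 0 \<in> ext_set (carrier G) \<and> s 1 \<in> ext_set (carrier G) \<and> s 2 \<in> ext_set (carrier G))"
    by (intro transfer_imp transfer_conj transfer_graph transfer_carrier)
  from transfer_all[OF this, of "(\<lambda>_. x)(1 := y, 2 := z)"]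
  show "x \<in> ext_set (carrier G)" "y \<in> ext_set (carrier G)" "z \<in> ext_set (carrier G)"
    using assms by (auto simp: graph_iff)
qed

lemma ext_graph_ex:
  assumes "x \<in> ext_set (carrier G)" "y \<in> ext_set (carrier G)"
  shows "\<exists>z \<in> tuples N d. x @ y @ z \<in> ext_graph"
proof -
  have "transfer d (\<lambda>s. s 0 \<in> carrier G \<and> s 1 \<in> carrier G \<longrightarrow>
        (\<exists>z \<in> tuples M d. (s(2 := z)) 0 @ (s(2 := z)) 1 @ (s(2 := z)) 2 \<in> mult_graph G))
      (\<lambda>s. s 0 \<in> ext_set (carrier G) \<and> s 1 \<in> ext_set (carrier G) \<longrightarrow>
        (\<exists>z \<in> tuples N d. (s(2 := z)) 0 @ (s(2 := z)) 1 @ (s(2 := z)) 2 \<in> ext_graph))"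
    by (intro transfer_imp transfer_conj transfer_carrier transfer_ex[OF transfer_graph])
  moreover have "\<exists>z \<in> tuples M d. (s(2 := z)) 0 @ (s(2 := z)) 1 @ (s(2 := z)) 2 \<in> mult_graph G"
    if "s 0 \<in> carrier G" "s 1 \<in> carrier G" for s :: "nat \<Rightarrow> 'm list"
    using that carrier_tuples by (intro bexI[of _ "s 0 \<otimes>\<^bsub>G\<^esub> s 1"]) (auto simp: mult_graph_def)
  ultimately show ?thesis
    using transfer_all[of d _ _ "(\<lambda>_. x)(1 := y)"] assms ext_set_tuples by fastforce
qed

lemma ext_graph_unique:
  assumes "x \<in> tuples N d" "y \<in> tuples N d" "z \<in> tuples N d" "z' \<in> tuples N d"
    "x @ y @ z \<in> ext_graph" "x @ y @ z' \<in> ext_graph"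
  shows "z = z'"
proof -
  have "transfer d (\<lambda>s. s 0 @ s 1 @ s 2 \<in> mult_graph G \<and> s 0 @ s 1 @ s 3 \<in> mult_graph G \<longrightarrow> s 2 = s 3)
      (\<lambda>s. s 0 @ s 1 @ s 2 \<in> ext_graph \<and> s 0 @ s 1 @ s 3 \<in> ext_graph \<longrightarrow> s 2 = s 3)"
    by (intro transfer_imp transfer_conj transfer_graph transfer_eq)
  from transfer_all[OF this, of "(\<lambda>_. x)(1 := y, 2 := z, 3 := z')"]
  show ?thesis using assms by (auto simp: graph_iff)
qed

text \<open>By transferred existence and uniqueness the extended graph is that of a function on
  pairs, which justifies the description operator in \<open>ext_group\<close>.\<close>

lemma ext_mult_iff:
  assumes "x \<in> ext_set (carrier G)" "y \<in> ext_set (carrier G)" "z \<in> tuples N d"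
  shows "x @ y @ z \<in> ext_graph \<longleftrightarrow> z = x \<otimes>\<^bsub>ext_G\<^esub> y"
proof -
  have xy: "x \<in> tuples N d" "y \<in> tuples N d" using assms ext_set_tuples by auto
  obtain w where w: "w \<in> tuples N d" "x @ y @ w \<in> ext_graph"
    using ext_graph_ex[OF assms(1,2)] by blast
  have "x \<otimes>\<^bsub>ext_G\<^esub> y = w"
    unfolding ext_group_def monoid.simps
  proof (rule the_equality)
    \<comment> \<open>Uniqueness was transferred for \<open>d\<close>-tuples only; that
      \<open>z\<close> is one follows from the length of the concatenation.\<close>
    fix z assume z: "x @ y @ z \<in> ext_graph"
    then have "x @ y @ z \<in> tuples N (3 * d)" using ext_subset_tuples by blast
    then have "z \<in> tuples N d" using xy by (auto simp: tuples_def)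
    then show "z = w" using ext_graph_unique[OF xy _ w(1) z w(2)] by blast
  qed (rule w(2))
  then show ?thesis using w ext_graph_unique[OF xy assms(3) w(1) _ w(2)] by auto
qed

lemma ext_mult:
  assumes "x \<in> ext_set (carrier G)" "y \<in> ext_set (carrier G)"
  shows "x \<otimes>\<^bsub>ext_G\<^esub> y \<in> ext_set (carrier G)" "x @ y @ (x \<otimes>\<^bsub>ext_G\<^esub> y) \<in> ext_graph"
proof -
  have xy: "x \<in> tuples N d" "y \<in> tuples N d" using assms ext_set_tuples by auto
  obtain w where w: "w \<in> tuples N d" "x @ y @ w \<in> ext_graph"
    using ext_graph_ex[OF assms] by blast
  moreover have "w = x \<otimes>\<^bsub>ext_G\<^esub> y" using ext_mult_iff[OF assms w(1)] w(2) by simp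
  ultimately show "x \<otimes>\<^bsub>ext_G\<^esub> y \<in> ext_set (carrier G)" "x @ y @ (x \<otimes>\<^bsub>ext_G\<^esub> y) \<in> ext_graph"
    using ext_graph_carrier(3)[OF xy w] by simp_all
qed

lemma ext_group_simps [simp]:
  "carrier ext_G = ext_set (carrier G)" "\<one>\<^bsub>ext_G\<^esub> = map e \<one>\<^bsub>G\<^esub>"
  by (simp_all add: ext_group_def)

lemma ext_point_mem:
  assumes "definable L M d H" "c \<in> H"
  shows "map e c \<in> ext_set H"
proof -
  have c: "c \<in> tuples M d" using assms definable_subset by blast
  have "transfer d (\<lambda>s. s 0 = c \<longrightarrow> s 0 \<in> H) (\<lambda>s. s 0 = map e c \<longrightarrow> s 0 \<in> ext_set H)"
    by (intro transfer_imp transfer_eq_const c transfer_mem assms(1))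
  from transfer_all[OF this, of "\<lambda>_. map e c"] show ?thesis
    using assms(2) map_e_tuples[OF c] by auto
qed

text \<open>Each axiom is stated as a law about \<open>mult_graph\<close>, with a separate block for
  every intermediate product, and passes to \<open>N\<close> by \<open>transfer_all\<close>.\<close>

lemma group_ext: "group ext_G"
proof (rule groupI)
  show "\<one>\<^bsub>ext_G\<^esub> \<in> carrier ext_G"
    using ext_point_mem[OF def_carrier] by simp
  fix x y assume xy: "x \<in> carrier ext_G" "y \<in> carrier ext_G"
  then show "x \<otimes>\<^bsub>ext_G\<^esub> y \<in> carrier ext_G" using ext_mult by simp
  fix z assume z: "z \<in> carrier ext_G"
  have "transfer d (\<lambda>s. s 0 @ s 1 @ s 3 \<in> mult_graph G \<and> s 3 @ s 2 @ s 4 \<in> mult_graph G \<and>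
        s 1 @ s 2 @ s 5 \<in> mult_graph G \<longrightarrow> s 0 @ s 5 @ s 4 \<in> mult_graph G)
      (\<lambda>s. s 0 @ s 1 @ s 3 \<in> ext_graph \<and> s 3 @ s 2 @ s 4 \<in> ext_graph \<and>
        s 1 @ s 2 @ s 5 \<in> ext_graph \<longrightarrow> s 0 @ s 5 @ s 4 \<in> ext_graph)"
    by (intro transfer_imp transfer_conj transfer_graph)
  moreover have "s 0 @ s 1 @ s 3 \<in> mult_graph G \<and> s 3 @ s 2 @ s 4 \<in> mult_graph G \<and>
        s 1 @ s 2 @ s 5 \<in> mult_graph G \<longrightarrow> s 0 @ s 5 @ s 4 \<in> mult_graph G" if "env M d s" for s
    unfolding graph_iff[OF that] by (auto simp: G.m_assoc)
  ultimately have "env N d t \<Longrightarrow> t 0 @ t 1 @ t 3 \<in> ext_graph \<and> t 3 @ t 2 @ t 4 \<in> ext_graph \<and>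
        t 1 @ t 2 @ t 5 \<in> ext_graph \<longrightarrow> t 0 @ t 5 @ t 4 \<in> ext_graph" for t
    by (rule transfer_all)
  \<comment> \<open>Blocks 3 to 5 carry the product of \<open>x\<close> and \<open>y\<close>, the
    full product bracketed to the left, and the product of \<open>y\<close> and
    \<open>z\<close>.\<close>
  from this[of "(\<lambda>_. x)(1 := y, 2 := z, 3 := x \<otimes>\<^bsub>ext_G\<^esub> y,
      4 := x \<otimes>\<^bsub>ext_G\<^esub> y \<otimes>\<^bsub>ext_G\<^esub> z, 5 := y \<otimes>\<^bsub>ext_G\<^esub> z)"]
  have "x @ (y \<otimes>\<^bsub>ext_G\<^esub> z) @ (x \<otimes>\<^bsub>ext_G\<^esub> y \<otimes>\<^bsub>ext_G\<^esub> z) \<in> ext_graph"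
    using xy z by (simp add: ext_mult ext_carrier_tuples)
  then show "x \<otimes>\<^bsub>ext_G\<^esub> y \<otimes>\<^bsub>ext_G\<^esub> z = x \<otimes>\<^bsub>ext_G\<^esub> (y \<otimes>\<^bsub>ext_G\<^esub> z)"
    using xy z ext_mult_iff[of x "y \<otimes>\<^bsub>ext_G\<^esub> z"] by (simp add: ext_mult ext_carrier_tuples)
next
  fix x assume x: "x \<in> carrier ext_G"
  have one: "map e \<one>\<^bsub>G\<^esub> \<in> ext_set (carrier G)" using ext_point_mem[OF def_carrier] by simp
  have "transfer d (\<lambda>s. s 0 = \<one>\<^bsub>G\<^esub> \<and> s 1 \<in> carrier G \<longrightarrow> s 0 @ s 1 @ s 1 \<in> mult_graph G)
      (\<lambda>s. s 0 = map e \<one>\<^bsub>G\<^esub> \<and> s 1 \<in> ext_set (carrier G) \<longrightarrow> s 0 @ s 1 @ s 1 \<in> ext_graph)"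
    by (intro transfer_imp transfer_conj transfer_graph transfer_carrier transfer_eq_const one_tuple)
  moreover have "s 0 = \<one>\<^bsub>G\<^esub> \<and> s 1 \<in> carrier G \<longrightarrow> s 0 @ s 1 @ s 1 \<in> mult_graph G"
    if "env M d s" for s
    unfolding graph_iff[OF that] by auto
  ultimately have "env N d t \<Longrightarrow>
      t 0 = map e \<one>\<^bsub>G\<^esub> \<and> t 1 \<in> ext_set (carrier G) \<longrightarrow> t 0 @ t 1 @ t 1 \<in> ext_graph" for t
    by (rule transfer_all)
  from this[of "(\<lambda>_. x)(0 := map e \<one>\<^bsub>G\<^esub>)"]
  have "map e \<one>\<^bsub>G\<^esub> @ x @ x \<in> ext_graph"
    using x one by (simp add: ext_carrier_tuples)
  then show "\<one>\<^bsub>ext_G\<^esub> \<otimes>\<^bsub>ext_G\<^esub> x = x"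
    using ext_mult_iff[of "map e \<one>\<^bsub>G\<^esub>" x x] x one by (simp add: ext_carrier_tuples)
  have "transfer d (\<lambda>s. s 0 = \<one>\<^bsub>G\<^esub> \<and> s 1 \<in> carrier G \<longrightarrow>
        (\<exists>y \<in> tuples M d. (s(2 := y)) 2 @ (s(2 := y)) 1 @ (s(2 := y)) 0 \<in> mult_graph G))
      (\<lambda>s. s 0 = map e \<one>\<^bsub>G\<^esub> \<and> s 1 \<in> ext_set (carrier G) \<longrightarrow>
        (\<exists>y \<in> tuples N d. (s(2 := y)) 2 @ (s(2 := y)) 1 @ (s(2 := y)) 0 \<in> ext_graph))"
    by (intro transfer_imp transfer_conj transfer_carrier transfer_eq_const one_tuple
        transfer_ex[OF transfer_graph])
  moreover have "s 0 = \<one>\<^bsub>G\<^esub> \<and> s 1 \<in> carrier G \<longrightarrow>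
      (\<exists>y \<in> tuples M d. (s(2 := y)) 2 @ (s(2 := y)) 1 @ (s(2 := y)) 0 \<in> mult_graph G)"
    if "env M d s" for s
  proof
    assume s: "s 0 = \<one>\<^bsub>G\<^esub> \<and> s 1 \<in> carrier G"
    then have inv: "inv\<^bsub>G\<^esub> (s 1) \<in> tuples M d" using carrier_tuples by auto
    show "\<exists>y \<in> tuples M d. (s(2 := y)) 2 @ (s(2 := y)) 1 @ (s(2 := y)) 0 \<in> mult_graph G"
      by (rule bexI[OF _ inv], unfold graph_iff[OF env_upd[OF inv that]]) (use s in simp)
  qed
  ultimately have "env N d t \<Longrightarrow> t 0 = map e \<one>\<^bsub>G\<^esub> \<and> t 1 \<in> ext_set (carrier G) \<longrightarrow>
      (\<exists>y \<in> tuples N d. (t(2 := y)) 2 @ (t(2 := y)) 1 @ (t(2 := y)) 0 \<in> ext_graph)" for t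
    by (rule transfer_all)
  from this[of "(\<lambda>_. x)(0 := map e \<one>\<^bsub>G\<^esub>)"]
  have "\<exists>y \<in> tuples N d. y @ x @ map e \<one>\<^bsub>G\<^esub> \<in> ext_graph"
    using x one by (simp add: ext_carrier_tuples)
  then obtain y where y: "y \<in> tuples N d" "y @ x @ map e \<one>\<^bsub>G\<^esub> \<in> ext_graph" by blast
  then have "y \<in> ext_set (carrier G)"
    using ext_graph_carrier(1)[of y x "map e \<one>\<^bsub>G\<^esub>"] x one by (simp add: ext_carrier_tuples)
  then show "\<exists>y \<in> carrier ext_G. y \<otimes>\<^bsub>ext_G\<^esub> x = \<one>\<^bsub>ext_G\<^esub>"
    using y ext_mult_iff[of y x "map e \<one>\<^bsub>G\<^esub>"] x one by (auto simp: ext_carrier_tuples)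
qed

sublocale ext_G: group ext_G
  by (rule group_ext)

text \<open>Closure is again a law about the graph; the inverse is described as the left factor in a
  product equal to the identity.\<close>

lemma subgroup_ext:
  assumes H: "subgroup H G" "definable L M d H"
  shows "subgroup (ext_set H) ext_G"
proof (rule subgroup.intro)
  have "transfer d (\<lambda>s. s 0 \<in> H \<longrightarrow> s 0 \<in> carrier G)
      (\<lambda>s. s 0 \<in> ext_set H \<longrightarrow> s 0 \<in> ext_set (carrier G))"
    by (intro transfer_imp transfer_mem H def_carrier)
  moreover have "s 0 \<in> H \<longrightarrow> s 0 \<in> carrier G" if "env M d s" for s
    using H(1) by (auto dest: subgroup.mem_carrier)
  ultimately have "env N d t \<Longrightarrow> t 0 \<in> ext_set H \<longrightarrow> t 0 \<in> ext_set (carrier G)" for t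
    by (rule transfer_all)
  from this[of "\<lambda>_. _"] have "x \<in> ext_set H \<Longrightarrow> x \<in> ext_set (carrier G)" for x
    using ext_set_tuples by simp
  then show sub: "ext_set H \<subseteq> carrier ext_G" by auto
  show "\<one>\<^bsub>ext_G\<^esub> \<in> ext_set H"
    using ext_point_mem[OF H(2)] subgroup.one_closed[OF H(1)] by simp
  fix x assume x: "x \<in> ext_set H"
  { fix y assume y: "y \<in> ext_set H"
    have "transfer d (\<lambda>s. s 0 \<in> H \<and> s 1 \<in> H \<and> s 0 @ s 1 @ s 2 \<in> mult_graph G \<longrightarrow> s 2 \<in> H)
        (\<lambda>s. s 0 \<in> ext_set H \<and> s 1 \<in> ext_set H \<and> s 0 @ s 1 @ s 2 \<in> ext_graph \<longrightarrow> s 2 \<in> ext_set H)"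
      by (intro transfer_imp transfer_conj transfer_mem H transfer_graph)
    moreover have "s 0 \<in> H \<and> s 1 \<in> H \<and> s 0 @ s 1 @ s 2 \<in> mult_graph G \<longrightarrow> s 2 \<in> H"
      if "env M d s" for s
      unfolding graph_iff[OF that] using H(1) by (auto simp: subgroup.m_closed)
    ultimately have "env N d t \<Longrightarrow>
        t 0 \<in> ext_set H \<and> t 1 \<in> ext_set H \<and> t 0 @ t 1 @ t 2 \<in> ext_graph \<longrightarrow> t 2 \<in> ext_set H" for t
      by (rule transfer_all)
    from this[of "(\<lambda>_. x)(1 := y, 2 := x \<otimes>\<^bsub>ext_G\<^esub> y)"]
    show "x \<otimes>\<^bsub>ext_G\<^esub> y \<in> ext_set H"
      using x y sub ext_mult[of x y] by (auto simp: ext_carrier_tuples subset_iff) }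
  have "transfer d (\<lambda>s. s 0 \<in> H \<and> s 1 = \<one>\<^bsub>G\<^esub> \<and> s 2 @ s 0 @ s 1 \<in> mult_graph G \<longrightarrow> s 2 \<in> H)
      (\<lambda>s. s 0 \<in> ext_set H \<and> s 1 = map e \<one>\<^bsub>G\<^esub> \<and> s 2 @ s 0 @ s 1 \<in> ext_graph \<longrightarrow> s 2 \<in> ext_set H)"
    by (intro transfer_imp transfer_conj transfer_mem H transfer_graph transfer_eq_const one_tuple)
  moreover have "s 0 \<in> H \<and> s 1 = \<one>\<^bsub>G\<^esub> \<and> s 2 @ s 0 @ s 1 \<in> mult_graph G \<longrightarrow> s 2 \<in> H"
    if "env M d s" for s
    unfolding graph_iff[OF that]
    using H(1) G.inv_equality[of "s 2" "s 0"] by (auto dest: subgroup.m_inv_closed)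
  ultimately have inv: "env N d t \<Longrightarrow>
      t 0 \<in> ext_set H \<and> t 1 = map e \<one>\<^bsub>G\<^esub> \<and> t 2 @ t 0 @ t 1 \<in> ext_graph \<longrightarrow> t 2 \<in> ext_set H" for t
    by (rule transfer_all)
  have xc: "x \<in> ext_set (carrier G)" using x sub by auto
  then have ic: "inv\<^bsub>ext_G\<^esub> x \<in> ext_set (carrier G)" using ext_G.inv_closed[of x] by simp
  have "inv\<^bsub>ext_G\<^esub> x @ x @ map e \<one>\<^bsub>G\<^esub> \<in> ext_graph"
    using ext_mult(2)[OF ic xc] ext_G.l_inv[of x] xc by simp
  then show "inv\<^bsub>ext_G\<^esub> x \<in> ext_set H"
    using inv[of "(\<lambda>_. x)(1 := map e \<one>\<^bsub>G\<^esub>, 2 := inv\<^bsub>ext_G\<^esub> x)"] x xc ic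
      map_e_tuples[OF one_tuple] by (simp add: ext_carrier_tuples)
qed

text \<open>That finitely many cosets cover a finite intersection is a first-order law with the
  representatives as parameters. Hence the representatives from \<open>M\<close> still suffice in
  \<open>N\<close>, which is how a finite index persists.\<close>

lemma ext_cover:
  assumes S: "finite S" "\<And>K. K \<in> S \<Longrightarrow> definable L M d K" and H: "definable L M d H"
    and J: "finite J" "J \<subseteq> carrier G"
    and cover: "\<And>x. x \<in> tuples M d \<Longrightarrow> (\<forall>K \<in> S. x \<in> K) \<Longrightarrow> \<exists>g \<in> J. \<exists>h \<in> H. h \<in> carrier G \<and> x = h \<otimes>\<^bsub>G\<^esub> g"
    and x: "x \<in> tuples N d" "\<And>K. K \<in> S \<Longrightarrow> x \<in> ext_set K"
  shows "\<exists>g \<in> J. \<exists>h \<in> ext_set H. h @ map e g @ x \<in> ext_graph"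
proof -
  have J_tuples: "g \<in> J \<Longrightarrow> g \<in> tuples M d" for g using J(2) carrier_tuples by auto
  \<comment> \<open>Block 0 is the element to be covered, block 1 the factor in \<open>H\<close> and
    block 2 the representative.\<close>
  let ?P = "\<lambda>g s. s 1 \<in> H \<and> s 2 = g \<and> s 1 @ s 2 @ s 0 \<in> mult_graph G"
  let ?Q = "\<lambda>g s. s 1 \<in> ext_set H \<and> s 2 = map e g \<and> s 1 @ s 2 @ s 0 \<in> ext_graph"
  have "transfer d (?P g) (?Q g)" if "g \<in> J" for g
    using that by (intro transfer_conj transfer_mem H transfer_graph transfer_eq_const J_tuples)
  then have "transfer d (\<lambda>s. (\<forall>K \<in> S. s 0 \<in> K) \<longrightarrow>
        (\<exists>g \<in> J. \<exists>z \<in> tuples M d. \<exists>y \<in> tuples M d. ?P g (s(2 := z, 1 := y))))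
      (\<lambda>s. (\<forall>K \<in> S. s 0 \<in> ext_set K) \<longrightarrow>
        (\<exists>g \<in> J. \<exists>z \<in> tuples N d. \<exists>y \<in> tuples N d. ?Q g (s(2 := z, 1 := y))))"
    using S J(1)
    by (intro transfer_imp transfer_ball transfer_bex transfer_mem
        transfer_ex[where k = 2 and P = "\<lambda>s. \<exists>y \<in> tuples M d. ?P _ (s(1 := y))"
          and Q = "\<lambda>s. \<exists>y \<in> tuples N d. ?Q _ (s(1 := y))"]
        transfer_ex[where k = 1]) auto
  moreover have "(\<forall>K \<in> S. s 0 \<in> K) \<longrightarrow>
      (\<exists>g \<in> J. \<exists>z \<in> tuples M d. \<exists>y \<in> tuples M d. ?P g (s(2 := z, 1 := y)))"
    if "env M d s" for s
  proof
    assume "\<forall>K \<in> S. s 0 \<in> K"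
    note s = that this
    have "s 0 \<in> tuples M d" using s(1) by (simp add: env_def)
    then obtain g h where gh: "g \<in> J" "h \<in> H" "h \<in> carrier G" "s 0 = h \<otimes>\<^bsub>G\<^esub> g"
      using cover s(2) by blast
    then have "h \<in> tuples M d" "g \<in> tuples M d" "h @ g @ s 0 \<in> mult_graph G"
      using J(2) carrier_tuples by (auto simp: mult_graph_def)
    then show "\<exists>g \<in> J. \<exists>z \<in> tuples M d. \<exists>y \<in> tuples M d. ?P g (s(2 := z, 1 := y))"
      using gh by (intro bexI[of _ g] bexI[of _ h]) auto
  qed
  ultimately have "env N d t \<Longrightarrow> (\<forall>K \<in> S. t 0 \<in> ext_set K) \<longrightarrow>
      (\<exists>g \<in> J. \<exists>z \<in> tuples N d. \<exists>y \<in> tuples N d. ?Q g (t(2 := z, 1 := y)))" for t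
    by (rule transfer_all)
  from this[of "\<lambda>_. x"] show ?thesis using x by auto
qed

text \<open>Members of the family are carved out of the carrier, so the uniform formula is conjoined
  with one defining the carrier.\<close>

lemma definable_subgroups:
  assumes "uniformly_definable_subgroups L M d G F" "H \<in> F"
  shows "definable L M d H"
proof -
  obtain q \<phi> where "\<phi> \<in> fms L (d + q)"
    and "\<forall>H \<in> F. \<exists>a \<in> tuples M q. H = {g \<in> carrier G. holds M \<phi> (g @ a)}"
    using assms(1) unfolding uniformly_definable_subgroups_def by blast
  then obtain a where \<phi>: "\<phi> \<in> fms L (d + q)" "a \<in> tuples M q"
    and H: "H = {g \<in> carrier G. holds M \<phi> (g @ a)}"
    using assms(2) by metis
  have "transfer d (\<lambda>s. s 0 \<in> carrier G \<and> holds M \<phi> (concat (map s [0]) @ a))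
      (\<lambda>s. s 0 \<in> ext_set (carrier G) \<and> holds N \<phi> (concat (map s [0]) @ map e a))"
    using \<phi> by (intro transfer_conj transfer_carrier transfer_holds) (auto simp: tuples_def)
  from transfer_definable(1)[OF this]
  have "definable L M d {x \<in> tuples M d. x \<in> carrier G \<and> holds M \<phi> (x @ a)}" by simp
  moreover have "{x \<in> tuples M d. x \<in> carrier G \<and> holds M \<phi> (x @ a)} = H"
    using carrier_tuples by (auto simp: H)
  ultimately show ?thesis by simp
qed

end

subsection \<open>Bounded index\<close>

text \<open>One representative from each coset gives a cover by cosets of \<open>H\<close>, the form
  that \<open>ext_cover\<close> takes.\<close>

lemma finite_cosets_cover:
  fixes G :: "'a monoid" (structure)
  assumes "group G" "subgroup K G" "subgroup H G" "finite (cosets_in G K (K \<inter> H))"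
  shows "\<exists>J. finite J \<and> J \<subseteq> K \<and> (\<forall>x \<in> K. \<exists>g \<in> J. \<exists>h \<in> H. h \<in> carrier G \<and> x = h \<otimes> g)"
proof -
  interpret group G by fact
  have KH: "subgroup (K \<inter> H) G" using assms(2,3) by (rule subgroups_Inter_pair)
  obtain J where J: "J \<subseteq> K" "finite J" "(\<lambda>a. (K \<inter> H) #> a) ` K = (\<lambda>a. (K \<inter> H) #> a) ` J"
    using finite_subset_image[OF assms(4)[unfolded cosets_in_eq] subset_refl] by blast
  have "\<exists>g \<in> J. \<exists>h \<in> H. h \<in> carrier G \<and> x = h \<otimes> g" if x: "x \<in> K" for x
  proof -
    have "(K \<inter> H) #> x \<in> (\<lambda>a. (K \<inter> H) #> a) ` J" using x J(3) by blast
    then obtain g where g: "g \<in> J" "(K \<inter> H) #> x = (K \<inter> H) #> g" by blast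
    have "x \<in> (K \<inter> H) #> x"
      using rcos_self[OF subgroup.mem_carrier[OF assms(2) x] KH] .
    then obtain h where "h \<in> K \<inter> H" "x = h \<otimes> g"
      using g(2) by (auto simp: r_coset_def)
    then show ?thesis using g(1) subgroup.mem_carrier[OF assms(3)] by blast
  qed
  then show ?thesis using J by blast
qed

lemma (in group) mult_inv_cancel_right:
  assumes "x \<in> carrier G" "y \<in> carrier G" "z \<in> carrier G"
  shows "(x \<otimes> z) \<otimes> inv (y \<otimes> z) = x \<otimes> inv y"
proof -
  have "z \<otimes> (inv z \<otimes> inv y) = inv y"
    using assms by (simp add: m_assoc[symmetric])
  then show ?thesis using assms by (simp add: inv_mult_group m_assoc)
qed

text \<open>By \<open>le\<close> a realization of \<open>R\<close> lies in the extension of every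
  member of \<open>S0\<close>, hence for each \<open>H\<close> in \<open>S\<close> in one of
  finitely many cosets with representatives from \<open>M\<close>. The choice of a representative
  for each \<open>H\<close> determines the coset modulo the whole intersection, and such choices are
  coded by sets of pairs of a formula and a tuple.\<close>

lemma bounded_index_if_finite_index:
  fixes L :: "('f, 'r) language" and M :: "('f, 'r, 'm) struct"
  assumes large: "(UNIV :: (('f, 'r) fm \<times> 'm list) set set) \<prec> (UNIV :: 'u set)"
    and M: "is_structure L M"
    and G: "definable_group L M d G"
    and F: "uniformly_definable_subgroups L M d G F"
    and S: "S \<subseteq> F" "S \<noteq> {}"
    and S0: "S0 \<subseteq> F" "S0 \<noteq> {}" "finite S0"
    and le: "type_le L M d R S0 TYPE('u)"
    and fin: "\<And>H. H \<in> S \<Longrightarrow> finite (cosets_in G (\<Inter>S0) (\<Inter>S0 \<inter> H))"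
  shows "bounded_index L M d G S R TYPE('u)"
proof -
  have group: "group G" using G by (simp add: definable_group_def)
  have sub: "subgroup H G" if "H \<in> F" for H
    using F that by (simp add: uniformly_definable_subgroups_def)
  obtain q \<phi> where "\<forall>H \<in> F. \<exists>a \<in> tuples M q. H = {g \<in> carrier G. holds M \<phi> (g @ a)}"
    using F unfolding uniformly_definable_subgroups_def by blast
  then obtain z where z: "\<And>H. H \<in> F \<Longrightarrow> H = {g \<in> carrier G. holds M \<phi> (g @ z H)}"
    by metis
  \<comment> \<open>Members of \<open>F\<close> are named by their parameters, so that a function on
    \<open>S\<close> can be coded with tuples of \<open>M\<close>.\<close>
  have z_inj: "H = H'" if "H \<in> F" "H' \<in> F" "z H = z H'" for H H'
    using z[OF that(1)] z[OF that(2)] that(3) by simp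
  have sub0: "subgroup (\<Inter>S0) G"
    using S0 sub by (intro group.subgroups_Inter[OF group]) auto
  have "\<forall>H. \<exists>J. H \<in> S \<longrightarrow> finite J \<and> J \<subseteq> \<Inter>S0 \<and>
      (\<forall>x \<in> \<Inter>S0. \<exists>g \<in> J. \<exists>h \<in> H. h \<in> carrier G \<and> x = h \<otimes>\<^bsub>G\<^esub> g)"
  proof
    fix H
    show "\<exists>J. H \<in> S \<longrightarrow> finite J \<and> J \<subseteq> \<Inter>S0 \<and>
      (\<forall>x \<in> \<Inter>S0. \<exists>g \<in> J. \<exists>h \<in> H. h \<in> carrier G \<and> x = h \<otimes>\<^bsub>G\<^esub> g)"
    proof (cases "H \<in> S")
      case True
      then have "H \<in> F" using S(1) by blast
      from finite_cosets_cover[OF group sub0 sub[OF this] fin[OF True]] show ?thesis by simp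
    qed simp
  qed
  then obtain J where J: "\<And>H. H \<in> S \<Longrightarrow> finite (J H)" "\<And>H. H \<in> S \<Longrightarrow> J H \<subseteq> \<Inter>S0"
    "\<And>H x. H \<in> S \<Longrightarrow> x \<in> \<Inter>S0 \<Longrightarrow> \<exists>g \<in> J H. \<exists>h \<in> H. h \<in> carrier G \<and> x = h \<otimes>\<^bsub>G\<^esub> g"
    by metis
  obtain j :: "(('f, 'r) fm \<times> 'm list) set \<Rightarrow> 'u" where j: "inj j"
    using large by (auto simp: lesspoll_def lepoll_def)
  show ?thesis
    unfolding bounded_index_def
  \<comment> \<open>The bound is a copy in \<open>'u\<close> of the set of all possible codes,
    chosen before \<open>N\<close>.\<close>
  proof (intro exI[of _ "range j"] conjI allI impI)
    show "range j \<prec> (UNIV :: 'u set)"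
      using large j by simp
    fix N :: "('f, 'r, 'u) struct" and e :: "'m \<Rightarrow> 'u"
    assume e: "elementary_ext L M N e"
    interpret elem_ext_group L M N e d G
      using M e G by unfold_locales
    have def_F: "definable L M d H" if "H \<in> F" for H
      using definable_subgroups[OF F that] .
    have sub_ext: "subgroup (ext_set H) ext_G" if "H \<in> F" for H
      using that by (intro subgroup_ext sub def_F)
    let ?S = "realizations L M N e d S" and ?R = "realizations L M N e d R"
    have "subgroup (\<Inter>H \<in> S. ext_set H) ext_G"
      using S by (intro ext_G.subgroup_INT sub_ext) auto
    then have sub_S: "subgroup ?S ext_G" by (simp add: realizations_def)
    have R: "r \<in> ext_set K" if "r \<in> ?R" "K \<in> S0" for r K
    proof -
      have "?R \<subseteq> realizations L M N e d S0" using le e by (simp add: type_le_def)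
      then show ?thesis using that by (auto simp: realizations_def)
    qed
    have R_carrier: "r \<in> carrier ext_G" if "r \<in> ?R" for r
    proof -
      obtain K where "K \<in> S0" using S0(2) by blast
      then show ?thesis
        using R[OF that] S0(1) subgroup.mem_carrier[OF sub_ext] by blast
    qed
    have cover: "\<exists>g. g \<in> J H \<and> (\<exists>h \<in> ext_set H. r = h \<otimes>\<^bsub>ext_G\<^esub> map e g)" if "H \<in> S" "r \<in> ?R" for H r
    proof -
      have H: "H \<in> F" using that S(1) by blast
      have JG: "J H \<subseteq> carrier G"
        using J(2)[OF that(1)] sub0 subgroup.subset by blast
      have r: "r \<in> tuples N d" using R_carrier[OF that(2)] by (simp add: ext_carrier_tuples)
      have "\<exists>g \<in> J H. \<exists>h \<in> ext_set H. h @ map e g @ r \<in> ext_graph"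
        using J(3)[OF that(1)] S0 R[OF that(2)]
        by (intro ext_cover[where S = S0] J(1)[OF that(1)] JG r def_F H) auto
      then obtain g h where gh: "g \<in> J H" "h \<in> ext_set H" "h @ map e g @ r \<in> ext_graph" by blast
      have "map e g \<in> tuples N d" using gh(1) JG carrier_tuples map_e_tuples by blast
      moreover have "h \<in> tuples N d" using gh(2) by (rule ext_set_tuples)
      ultimately have "h \<in> ext_set (carrier G)" "map e g \<in> ext_set (carrier G)"
        using ext_graph_carrier(1,2) r gh(3) by blast+
      then have "r = h \<otimes>\<^bsub>ext_G\<^esub> map e g" using gh(3) r by (simp add: ext_mult_iff)
      then show ?thesis using gh by blast
    qed
    define \<gamma> where "\<gamma> H r = (SOME g. g \<in> J H \<and> (\<exists>h \<in> ext_set H. r = h \<otimes>\<^bsub>ext_G\<^esub> map e g))" for H r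
    have \<gamma>: "\<gamma> H r \<in> J H \<and> (\<exists>h \<in> ext_set H. r = h \<otimes>\<^bsub>ext_G\<^esub> map e (\<gamma> H r))" if "H \<in> S" "r \<in> ?R" for H r
      unfolding \<gamma>_def by (rule someI_ex) (rule cover[OF that])
    \<comment> \<open>A coset is determined by the representatives \<open>\<gamma> H r\<close>; the formula records where to split
      the concatenated tuple.\<close>
    define code :: "'u list \<Rightarrow> (('f, 'r) fm \<times> 'm list) set" where
      "code r = (\<lambda>H. (Eql (Var (length (z H))) (Var 0), z H @ \<gamma> H r)) ` S" for r
    have code: "?S #>\<^bsub>ext_G\<^esub> r = ?S #>\<^bsub>ext_G\<^esub> r'" if r: "r \<in> ?R" "r' \<in> ?R" "code r = code r'" for r r'
    proof (rule ext_G.rcos_eqI[OF sub_S R_carrier[OF r(1)] R_carrier[OF r(2)]])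
      have "r \<otimes>\<^bsub>ext_G\<^esub> inv\<^bsub>ext_G\<^esub> r' \<in> ext_set H" if H: "H \<in> S" for H
      proof -
        have "(Eql (Var (length (z H))) (Var 0), z H @ \<gamma> H r) \<in> code r'"
          using H r(3) by (auto simp: code_def)
        then obtain H' where "H' \<in> S" "z H = z H'" "\<gamma> H r = \<gamma> H' r'"
          by (auto simp: code_def)
        \<comment> \<open>Equal parameters force \<open>H' = H\<close>, so the two codes record the
          same representative at \<open>H\<close>.\<close>
        then have eq: "\<gamma> H r = \<gamma> H r'" using z_inj[of H H'] H S(1) by auto
        obtain h h' g where h: "h \<in> ext_set H" "h' \<in> ext_set H"
          "r = h \<otimes>\<^bsub>ext_G\<^esub> map e g" "r' = h' \<otimes>\<^bsub>ext_G\<^esub> map e g" and "g \<in> J H"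
          using \<gamma>[OF H r(1)] \<gamma>[OF H r(2)] unfolding eq by blast
        have HF: "subgroup (ext_set H) ext_G" using H S(1) by (intro sub_ext) auto
        have hc: "h \<in> carrier ext_G" "h' \<in> carrier ext_G"
          using h subgroup.mem_carrier[OF HF] by blast+
        have "g \<in> carrier G"
          using \<open>g \<in> J H\<close> J(2)[OF H] subgroup.subset[OF sub0] by blast
        then have gc: "map e g \<in> carrier ext_G"
          using ext_point_mem[OF def_carrier] by simp
        have "r \<otimes>\<^bsub>ext_G\<^esub> inv\<^bsub>ext_G\<^esub> r' = h \<otimes>\<^bsub>ext_G\<^esub> inv\<^bsub>ext_G\<^esub> h'"
          unfolding h(3,4)
          by (rule ext_G.mult_inv_cancel_right[OF hc gc])
        then show ?thesis
          using h(1,2) HF by (simp add: subgroup.m_closed subgroup.m_inv_closed)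
      qed
      then show "r \<otimes>\<^bsub>ext_G\<^esub> inv\<^bsub>ext_G\<^esub> r' \<in> ?S" by (auto simp: realizations_def)
    qed
    have "cosets_in ext_G ?R ?S = (\<lambda>r. ?S #>\<^bsub>ext_G\<^esub> r) ` ?R"
      by (rule cosets_in_eq)
    also have "\<dots> \<lesssim> code ` ?R"
    proof -
      \<comment> \<open>The coset of \<open>r\<close> depends on \<open>code r\<close> only, so the
        set of cosets is an image of the set of codes.\<close>
      have "(\<lambda>r. ?S #>\<^bsub>ext_G\<^esub> r) ` ?R = (\<lambda>c. ?S #>\<^bsub>ext_G\<^esub> (SOME r. r \<in> ?R \<and> code r = c)) ` (code ` ?R)"
        unfolding image_image
      proof (rule image_cong[OF refl])
        fix r assume r: "r \<in> ?R"
        have "(SOME r'. r' \<in> ?R \<and> code r' = code r) \<in> ?R \<and>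
            code (SOME r'. r' \<in> ?R \<and> code r' = code r) = code r"
          by (rule someI[of "\<lambda>r'. r' \<in> ?R \<and> code r' = code r" r]) (use r in simp)
        then show "?S #>\<^bsub>ext_G\<^esub> r = ?S #>\<^bsub>ext_G\<^esub> (SOME r'. r' \<in> ?R \<and> code r' = code r)"
          using code[OF r] by simp
      qed
      then show ?thesis by (simp only: image_lepoll)
    qed
    also have "code ` ?R \<lesssim> (UNIV :: (('f, 'r) fm \<times> 'm list) set set)"
      by (rule subset_imp_lepoll) simp
    also have "\<dots> \<lesssim> range j"
      using j by (simp add: lepoll_def) blast
    finally show "cosets_in (ext_group L M N e d G) ?R ?S \<lesssim> range j" .
  qed
qed

text \<open>The next element is chosen in view of the set of all earlier ones. Constant
  \<open>A\<close> serves the selection inside one family; varying \<open>A\<close> serves a chain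
  of families.\<close>

lemma greedy_sequence:
  assumes "h0 \<in> A 0"
    and step: "\<And>m X. m < n \<Longrightarrow> X \<subseteq> (\<Union>i\<le>m. A i) \<Longrightarrow> finite X \<Longrightarrow> X \<noteq> {} \<Longrightarrow> card X \<le> Suc m \<Longrightarrow>
      \<exists>h \<in> A (Suc m). P X h"
  shows "\<exists>H. (\<forall>i \<le> n. H i \<in> A i) \<and> (\<forall>i < n. P (H ` {..i}) (H (Suc i)))"
proof -
  have "\<exists>H. (\<forall>i \<le> m. H i \<in> A i) \<and> (\<forall>i < m. P (H ` {..i}) (H (Suc i)))" if "m \<le> n" for m
    using that
  proof (induction m)
    case 0
    then show ?case using assms(1) by auto
  next
    case (Suc m)
    then obtain H where H: "\<And>i. i \<le> m \<Longrightarrow> H i \<in> A i" "\<And>i. i < m \<Longrightarrow> P (H ` {..i}) (H (Suc i))"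
      by auto
    have "card (H ` {..m}) \<le> Suc m" using card_image_le[of "{..m}" H] by simp
    then obtain h where h: "h \<in> A (Suc m)" "P (H ` {..m}) h"
      using step[of m "H ` {..m}"] Suc.prems H(1) by auto
    define H' where "H' = H(Suc m := h)"
    have H': "H' i = H i" "H' ` {..i} = H ` {..i}" if "i \<le> m" for i
      using that by (auto simp: H'_def)
    moreover have "H' (Suc m) = h" by (simp add: H'_def)
    ultimately show ?case using H h
      by (intro exI[of _ H']) (auto simp: le_Suc_eq less_Suc_eq)
  qed
  then show ?thesis by blast
qed

section \<open>Inclusion of type-definable groups, and the bounds\<close>

lemma type_le_member: "H \<in> S \<Longrightarrow> type_le L M d S {H} U"
  by (auto simp: type_le_def realizations_def)

lemma type_le_iff: "type_le L M d S R U \<longleftrightarrow> (\<forall>H \<in> R. type_le L M d S {H} U)"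
  by (auto simp: type_le_def realizations_def)

lemma type_le_trans: "type_le L M d S R U \<Longrightarrow> type_le L M d R Q U \<Longrightarrow> type_le L M d S Q U"
  unfolding type_le_def by blast

text \<open>All bounds are the single \<open>n\<close> of \<open>intersection_chain_bound\<close>.
  The choice of \<open>S0\<close> appears twice: within the given family \<open>S\<close>, and among
  all members of \<open>F\<close> that contain the group represented by \<open>S\<close>. By
  \<open>large\<close>, the type \<open>'u\<close> can carry the ultrapower and the bound on the
  index.\<close>

theorem theorem1p9:
  fixes L :: "('f, 'r) language" and T :: "('f, 'r) fm set" and M :: "('f, 'r, 'm) struct"
    and d :: nat and G :: "'m list monoid" and F :: "'m list set set"
  assumes large: "(UNIV :: (('f, 'r) fm \<times> 'm list) set set) \<prec> (UNIV :: 'u set)"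
    and simple: "simple_theory L T TYPE('u)"
    and model: "models L M T"
    and G: "definable_group L M d G"
    and F: "uniformly_definable_subgroups L M d G F"
  shows "(\<exists>k k' :: nat. \<forall>S. S \<subseteq> F \<and> S \<noteq> {} \<longrightarrow>
            (\<exists>S0. S0 \<subseteq> S \<and> S0 \<noteq> {} \<and> finite S0 \<and> card S0 \<le> k \<and>
               commensurable L M d G S S0 TYPE('u) \<and>
               (\<forall>H \<in> S. index_le G (\<Inter>S0) (\<Inter>S0 \<inter> H) k')) \<and>
            (\<exists>S0. S0 \<subseteq> {H \<in> F. type_le L M d S {H} TYPE('u)} \<and> S0 \<noteq> {} \<and>
               finite S0 \<and> card S0 \<le> k \<and>
               commensurable L M d G S S0 TYPE('u) \<and>
               (\<forall>H \<in> F. type_le L M d S {H} TYPE('u) \<longrightarrow>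
                  index_le G (\<Inter>S0) (\<Inter>S0 \<inter> H) k')))
       \<and> (\<exists>n :: nat. \<forall>C :: 'm list set set list.
            (\<forall>S \<in> set C. S \<subseteq> F \<and> S \<noteq> {}) \<and>
            (\<forall>i. Suc i < length C \<longrightarrow>
               type_le L M d (C ! Suc i) (C ! i) TYPE('u) \<and>
               \<not> bounded_index L M d G (C ! Suc i) (C ! i) TYPE('u)) \<longrightarrow>
            length C \<le> n)"
proof -
  have M: "is_structure L M" using model by (simp add: models_def)
  note bounded = bounded_index_if_finite_index[OF large M G F]
  obtain n where n: "\<And>H. (\<forall>i \<le> n. H i \<in> F) \<Longrightarrow>
      \<exists>i<n. index_le G (\<Inter>(H ` {..i})) (\<Inter>(H ` {..i}) \<inter> H (Suc i)) n"
    using intersection_chain_bound[OF large simple model G F] by blast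
  let ?idx = "\<lambda>X H. index_le G (\<Inter>X) (\<Inter>X \<inter> H) n"
  have core: "\<exists>S0. S0 \<subseteq> S \<and> S0 \<noteq> {} \<and> finite S0 \<and> card S0 \<le> n \<and> (\<forall>H \<in> S. ?idx S0 H)"
    if S: "S \<subseteq> F" "S \<noteq> {}" for S
  proof (rule ccontr)
    assume not: "\<not> ?thesis"
    \<comment> \<open>As \<open>m < n\<close>, the set \<open>X\<close> has at most \<open>n\<close>
      members and so fails as a choice of \<open>S0\<close>, which supplies the next
      \<open>h\<close>.\<close>
    have "\<exists>h \<in> S. \<not> ?idx X h"
      if "m < n" "X \<subseteq> (\<Union>i\<le>m. S)" "finite X" "X \<noteq> {}" "card X \<le> Suc m" for m X
    proof -
      have "X \<subseteq> S" using that(2) by auto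
      moreover have "card X \<le> n" using that(1,5) by simp
      ultimately show ?thesis using not that(3,4) by blast
    qed
    moreover obtain h0 where "h0 \<in> S" using S(2) by blast
    ultimately obtain H where H: "\<forall>i \<le> n. H i \<in> S" "\<forall>i < n. \<not> ?idx (H ` {..i}) (H (Suc i))"
      using greedy_sequence[of h0 "\<lambda>_. S" n "\<lambda>X H. \<not> ?idx X H"] by metis
    have "\<forall>i \<le> n. H i \<in> F" using H(1) S(1) by blast
    from n[OF this] show False using H(2) by blast
  qed
  have index_finite: "?idx S0 H \<Longrightarrow> finite (cosets_in G (\<Inter>S0) (\<Inter>S0 \<inter> H))" for S0 H
    by (simp add: index_le_def)
  \<comment> \<open>The groups represented by \<open>S\<close> and by \<open>S0\<close> are both
    contained in that of \<open>S0\<close>, so \<open>bounded\<close> applies to either with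
    \<open>S0\<close> as the finite family.\<close>
  have comm: "commensurable L M d G S S0 TYPE('u)"
    if S: "S \<subseteq> F" "S \<noteq> {}" and S0: "S0 \<subseteq> F" "S0 \<noteq> {}" "finite S0"
      and le: "type_le L M d S S0 TYPE('u)" and idx: "\<And>H. H \<in> S \<union> S0 \<Longrightarrow> ?idx S0 H" for S S0
  proof -
    have "type_le L M d S0 S0 TYPE('u)" by (simp add: type_le_def)
    then show ?thesis
      unfolding commensurable_def
      using S S0 le by (intro conjI bounded[OF _ _ S0] index_finite idx) auto
  qed
  have first: "\<exists>S0. S0 \<subseteq> S \<and> S0 \<noteq> {} \<and> finite S0 \<and> card S0 \<le> n \<and>
      commensurable L M d G S S0 TYPE('u) \<and> (\<forall>H \<in> S. ?idx S0 H)"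
    if S: "S \<subseteq> F" "S \<noteq> {}" for S
  proof -
    from core[OF S] obtain S0 where S0: "S0 \<subseteq> S" "S0 \<noteq> {}" "finite S0" "card S0 \<le> n"
      and idx: "\<forall>H \<in> S. ?idx S0 H"
      by (elim exE conjE)
    have le: "type_le L M d S S0 TYPE('u)"
      using S0(1) type_le_member by (subst type_le_iff) blast
    have "?idx S0 H" if "H \<in> S \<union> S0" for H
      using idx that S0(1) by blast
    from comm[OF S order_trans[OF S0(1) S(1)] S0(2,3) le this]
    have "commensurable L M d G S S0 TYPE('u)" .
    then show ?thesis using S0 idx by (intro exI[of _ S0]) simp
  qed
  \<comment> \<open>Applying \<open>core\<close> to all members of \<open>F\<close> that contain the
    group of \<open>S\<close>, in place of \<open>S\<close>, bounds the index for all of them at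
    once.\<close>
  let ?cl = "\<lambda>S. {H \<in> F. type_le L M d S {H} TYPE('u)}"
  have cl: "S \<subseteq> F \<Longrightarrow> S \<subseteq> ?cl S" for S
    using type_le_member by blast
  have second: "\<exists>S0. S0 \<subseteq> ?cl S \<and> S0 \<noteq> {} \<and> finite S0 \<and> card S0 \<le> n \<and>
      commensurable L M d G S S0 TYPE('u) \<and>
      (\<forall>H \<in> F. type_le L M d S {H} TYPE('u) \<longrightarrow> ?idx S0 H)"
    if S: "S \<subseteq> F" "S \<noteq> {}" for S
  proof -
    have cl_F: "?cl S \<subseteq> F" and cl_ne: "?cl S \<noteq> {}" using S cl[of S] by auto
    from core[OF this] obtain S0 where S0: "S0 \<subseteq> ?cl S" "S0 \<noteq> {}" "finite S0" "card S0 \<le> n"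
      and idx: "\<forall>H \<in> ?cl S. ?idx S0 H"
      by (elim exE conjE)
    have le: "type_le L M d S S0 TYPE('u)"
      using S0(1) by (subst type_le_iff) blast
    have "?idx S0 H" if "H \<in> S \<union> S0" for H
      using idx that S0(1) cl[OF S(1)] by blast
    from comm[OF S order_trans[OF S0(1) cl_F] S0(2,3) le this]
    have "commensurable L M d G S S0 TYPE('u)" .
    then show ?thesis using S0 idx by (intro exI[of _ S0]) simp
  qed
  have length_le: "length C \<le> n"
    if C: "\<And>S. S \<in> set C \<Longrightarrow> S \<subseteq> F \<and> S \<noteq> {}"
      and chain: "\<And>i. Suc i < length C \<Longrightarrow> type_le L M d (C ! Suc i) (C ! i) TYPE('u) \<and>
        \<not> bounded_index L M d G (C ! Suc i) (C ! i) TYPE('u)"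
    for C :: "'m list set set list"
  proof (rule ccontr)
    assume "\<not> length C \<le> n"
    \<comment> \<open>The entries \<open>C ! 0\<close> to \<open>C ! n\<close> exist and give
      \<open>n\<close> descents, as many as an \<open>n\<close>-chain has.\<close>
    then have len: "i \<le> n \<Longrightarrow> i < length C" for i by simp
    have C_nth: "C ! i \<subseteq> F" "C ! i \<noteq> {}" if "i \<le> n" for i
      using C[of "C ! i"] len[OF that] by auto
    have mono: "type_le L M d (C ! (i + l)) (C ! i) TYPE('u)" if "i + l \<le> n" for i l
      using that
    proof (induction l)
      case (Suc l)
      then show ?case
        using chain[of "i + l"] len[of "Suc (i + l)"] type_le_trans by fastforce
    qed (simp add: type_le_def)
    \<comment> \<open>The members of \<open>X\<close> come from families up to \<open>m\<close>, so
      all of them contain the group of \<open>C ! m\<close>. If every member of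
      \<open>C ! Suc m\<close> met \<open>\<Inter>X\<close> in index at most \<open>n\<close>, the
      descent to \<open>C ! Suc m\<close> would be bounded.\<close>
    have "\<exists>h \<in> C ! Suc m. \<not> ?idx X h"
      if m: "m < n" and X: "X \<subseteq> (\<Union>i\<le>m. C ! i)" "finite X" "X \<noteq> {}" for m X
    proof (rule ccontr)
      assume not: "\<not> ?thesis"
      have "type_le L M d (C ! m) {h} TYPE('u)" if h: "h \<in> X" for h
      proof -
        obtain i where i: "i \<le> m" "h \<in> C ! i" using X(1) h by auto
        then have "type_le L M d (C ! m) (C ! i) TYPE('u)"
          using mono[of i "m - i"] m by simp
        then show ?thesis by (rule type_le_trans) (rule type_le_member[OF i(2)])
      qed
      then have "type_le L M d (C ! m) X TYPE('u)" by (subst type_le_iff) blast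
      moreover have "(\<Union>i\<le>m. C ! i) \<subseteq> F"
        using C_nth(1) m by (intro UN_least) simp
      then have "X \<subseteq> F" using X(1) by blast
      ultimately have "bounded_index L M d G (C ! Suc m) (C ! m) TYPE('u)"
        using X not m C_nth[of "Suc m"] by (intro bounded[where ?S0.0 = X] index_finite) auto
      then show False using chain[of m] len[of "Suc m"] m by simp
    qed
    moreover obtain h0 where "h0 \<in> C ! 0" using C_nth(2)[of 0] by auto
    ultimately obtain H where H: "\<And>i. i \<le> n \<Longrightarrow> H i \<in> C ! i"
        "\<And>i. i < n \<Longrightarrow> \<not> ?idx (H ` {..i}) (H (Suc i))"
      using greedy_sequence[of h0 "\<lambda>i. C ! i" n "\<lambda>X H. \<not> ?idx X H"] by metis
    then have "\<forall>i \<le> n. H i \<in> F" using C_nth(1) by blast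
    then show False using n[of H] H(2) by blast
  qed
  have third: "\<exists>n :: nat. \<forall>C :: 'm list set set list.
      (\<forall>S \<in> set C. S \<subseteq> F \<and> S \<noteq> {}) \<and>
      (\<forall>i. Suc i < length C \<longrightarrow> type_le L M d (C ! Suc i) (C ! i) TYPE('u) \<and>
         \<not> bounded_index L M d G (C ! Suc i) (C ! i) TYPE('u)) \<longrightarrow> length C \<le> n"
    by (intro exI[of _ n] allI impI, elim conjE, rule length_le) simp_all
  show ?thesis
    using first second by (intro conjI third) (intro exI[of _ n] allI impI, elim conjE, intro conjI, simp_all)
qed

end
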